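(* Let $G$ be a nilpotent profinite group which is the inverse limit of a sequence of finite groups. If all faithful continuous representations of $G$ in isometry groups of locally finite rooted trees have small numbers of isometry types, then $G$ is a group of finite rank.
   Context: For a locally finite rooted tree $T$, $Iso(T)$ is the profinite group of all isometries of $T$ fixing the root. A faithful continuous representation of $G$ in $Iso(T)$ is a continuous injective homomorphism $G\to Iso(T)$ (so $G$ is realized as a closed subgroup). It has a small number of isometry types if the image of $G$ meets fewer than $2^{\aleph_0}$ conjugacy classes of $Iso(T)$. The rank of a profinite group $G$ is the supremum, over closed subgroups $H\le G$, of the minimal number of topological generators of $H$. *)

theory Defs
  imports
    "HOL-Analysis.Analysis"
    "HOL-Library.Extended_Nat"
    "HOL-Algebra.Bij"
    "HOL-Algebra.Generated_Groups"
    "HOL-Algebra.Product_Groups"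
begin

section \<open>Profinite groups\<close>

definition topological_group :: "('a, 'b) monoid_scheme \<Rightarrow> 'a topology \<Rightarrow> bool" where
  "topological_group G X \<longleftrightarrow>
     group G \<and> topspace X = carrier G \<and>
     continuous_map (prod_topology X X) X (\<lambda>(x, y). x \<otimes>\<^bsub>G\<^esub> y) \<and>
     continuous_map X X (\<lambda>x. inv\<^bsub>G\<^esub> x)"

definition profinite_group :: "('a, 'b) monoid_scheme \<Rightarrow> 'a topology \<Rightarrow> bool" where
  "profinite_group G X \<longleftrightarrow>
     topological_group G X \<and> compact_space X \<and> Hausdorff_space X \<and>
     (\<forall>S. connectedin X S \<longrightarrow> (\<exists>a. S \<subseteq> {a}))"

definition topological_group_isomorphic ::
  "('a, 'b) monoid_scheme \<Rightarrow> 'a topology \<Rightarrow> ('c, 'd) monoid_scheme \<Rightarrow> 'c topology \<Rightarrow> bool" where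
  "topological_group_isomorphic G X H Y \<longleftrightarrow> (\<exists>\<psi>. \<psi> \<in> iso G H \<and> homeomorphic_map X Y \<psi>)"

text \<open>The bonding maps \<open>f n\<close> go from \<open>K (Suc n)\<close> to \<open>K n\<close>; they are not required to be
  surjective.\<close>

definition finite_group_inverse_sequence ::
  "(nat \<Rightarrow> ('a, 'b) monoid_scheme) \<Rightarrow> (nat \<Rightarrow> 'a \<Rightarrow> 'a) \<Rightarrow> bool" where
  "finite_group_inverse_sequence K f \<longleftrightarrow>
     (\<forall>n. group (K n) \<and> finite (carrier (K n)) \<and> f n \<in> hom (K (Suc n)) (K n))"

definition inverse_limit ::
  "(nat \<Rightarrow> ('a, 'b) monoid_scheme) \<Rightarrow> (nat \<Rightarrow> 'a \<Rightarrow> 'a) \<Rightarrow> (nat \<Rightarrow> 'a) monoid" where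
  "inverse_limit K f = (product_group UNIV K)
     \<lparr>carrier := {x \<in> carrier (product_group UNIV K). \<forall>n. f n (x (Suc n)) = x n}\<rparr>"

definition inverse_limit_topology ::
  "(nat \<Rightarrow> ('a, 'b) monoid_scheme) \<Rightarrow> (nat \<Rightarrow> 'a \<Rightarrow> 'a) \<Rightarrow> (nat \<Rightarrow> 'a) topology" where
  "inverse_limit_topology K f =
     subtopology (product_topology (\<lambda>n. discrete_topology (carrier (K n))) UNIV)
       (carrier (inverse_limit K f))"

section \<open>Nilpotency, rank and conjugacy\<close>

primrec lower_central_series :: "('a, 'b) monoid_scheme \<Rightarrow> nat \<Rightarrow> 'a set" where
  "lower_central_series G 0 = carrier G"
| "lower_central_series G (Suc n) =
     generate G (\<Union>h \<in> lower_central_series G n. \<Union>g \<in> carrier G.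
       {h \<otimes>\<^bsub>G\<^esub> g \<otimes>\<^bsub>G\<^esub> inv\<^bsub>G\<^esub> h \<otimes>\<^bsub>G\<^esub> inv\<^bsub>G\<^esub> g})"

text \<open>Nilpotent of finite class as an abstract group, not merely pronilpotent.\<close>

definition nilpotent_group :: "('a, 'b) monoid_scheme \<Rightarrow> bool" where
  "nilpotent_group G \<longleftrightarrow> group G \<and> (\<exists>n. lower_central_series G n = {\<one>\<^bsub>G\<^esub>})"

text \<open>Least size of a finite set generating a dense subgroup of the closed subgroup \<open>H\<close>;
  it is \<open>\<infinity>\<close>, the infimum of the empty set, if there is no such finite set.\<close>

definition topological_generator_number ::
  "('a, 'b) monoid_scheme \<Rightarrow> 'a topology \<Rightarrow> 'a set \<Rightarrow> enat" where
  "topological_generator_number G X H =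
     Inf {enat (card S) |S. finite S \<and> S \<subseteq> H \<and> X closure_of (generate G S) = H}"

definition profinite_rank :: "('a, 'b) monoid_scheme \<Rightarrow> 'a topology \<Rightarrow> enat" where
  "profinite_rank G X =
     (SUP H \<in> {H. subgroup H G \<and> closedin X H}. topological_generator_number G X H)"

definition conjugacy_class :: "('a, 'b) monoid_scheme \<Rightarrow> 'a \<Rightarrow> 'a set" where
  "conjugacy_class G x = {g \<otimes>\<^bsub>G\<^esub> x \<otimes>\<^bsub>G\<^esub> inv\<^bsub>G\<^esub> g |g. g \<in> carrier G}"

definition conjugacy_classes :: "('a, 'b) monoid_scheme \<Rightarrow> 'a set set" where
  "conjugacy_classes G = conjugacy_class G ` carrier G"

section \<open>Locally finite rooted trees and their isometry groups\<close>

text \<open>Undirected simple graphs, with adjacency as a symmetric irreflexive relation.\<close>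

record 'v rooted_graph =
  verts :: "'v set"
  adj :: "('v \<times> 'v) set"
  root :: 'v

definition graph_cycle :: "('v \<times> 'v) set \<Rightarrow> 'v list \<Rightarrow> bool" where
  "graph_cycle E xs \<longleftrightarrow>
     3 \<le> length xs \<and> distinct xs \<and> successively (\<lambda>x y. (x, y) \<in> E) xs \<and> (last xs, hd xs) \<in> E"

definition rooted_tree :: "'v rooted_graph \<Rightarrow> bool" where
  "rooted_tree T \<longleftrightarrow>
     root T \<in> verts T \<and> adj T \<subseteq> verts T \<times> verts T \<and> sym (adj T) \<and> irrefl (adj T) \<and>
     (\<forall>u \<in> verts T. \<forall>v \<in> verts T. (u, v) \<in> (adj T)\<^sup>*) \<and>
     (\<nexists>xs. graph_cycle (adj T) xs)"

definition locally_finite_rooted_tree :: "'v rooted_graph \<Rightarrow> bool" where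
  "locally_finite_rooted_tree T \<longleftrightarrow>
     rooted_tree T \<and> (\<forall>v \<in> verts T. finite {w. (v, w) \<in> adj T})"

definition graph_dist :: "'v rooted_graph \<Rightarrow> 'v \<Rightarrow> 'v \<Rightarrow> nat" where
  "graph_dist T u v = (LEAST n. (u, v) \<in> adj T ^^ n)"

text \<open>As in \<^const>\<open>BijGroup\<close>, isometries are extensional on the vertex set.\<close>

definition Iso :: "'v rooted_graph \<Rightarrow> ('v \<Rightarrow> 'v) monoid" where
  "Iso T = BijGroup (verts T)
     \<lparr>carrier := {h \<in> Bij (verts T). h (root T) = root T \<and>
        (\<forall>u \<in> verts T. \<forall>v \<in> verts T. graph_dist T (h u) (h v) = graph_dist T u v)}\<rparr>"

text \<open>The profinite topology of \<open>Iso T\<close> is that of pointwise convergence on the discrete vertex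
  set: as balls around the root are finite, fixing finitely many vertices and fixing a ball
  pointwise define the same neighbourhoods of the identity.\<close>

definition Iso_topology :: "'v rooted_graph \<Rightarrow> ('v \<Rightarrow> 'v) topology" where
  "Iso_topology T =
     subtopology (product_topology (\<lambda>_. discrete_topology (verts T)) (verts T)) (carrier (Iso T))"

definition faithful_continuous_representation ::
  "('a, 'b) monoid_scheme \<Rightarrow> 'a topology \<Rightarrow> 'v rooted_graph \<Rightarrow> ('a \<Rightarrow> 'v \<Rightarrow> 'v) \<Rightarrow> bool" where
  "faithful_continuous_representation G X T \<phi> \<longleftrightarrow>
     \<phi> \<in> hom G (Iso T) \<and> inj_on \<phi> (carrier G) \<and> continuous_map X (Iso_topology T) \<phi>"

text \<open>The cardinality of \<open>UNIV :: nat set set\<close> is that of the continuum.\<close>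

definition small_number_of_isometry_types ::
  "('a, 'b) monoid_scheme \<Rightarrow> 'v rooted_graph \<Rightarrow> ('a \<Rightarrow> 'v \<Rightarrow> 'v) \<Rightarrow> bool" where
  "small_number_of_isometry_types G T \<phi> \<longleftrightarrow>
     {C \<in> conjugacy_classes (Iso T). C \<inter> \<phi> ` carrier G \<noteq> {}} \<prec> (UNIV :: nat set set)"

text \<open>A locally finite rooted tree has countably many vertices, hence is isomorphic to one whose
  vertices are natural numbers. Quantifying over all trees \<open>T :: nat rooted_graph\<close> therefore
  quantifies over all locally finite rooted trees, finite or infinite, up to isomorphism.\<close>

lemma locally_finite_rooted_tree_countable:
  assumes T: "locally_finite_rooted_tree T"
  shows "countable (verts T)"
proof -
  let ?B = "\<lambda>n. {v. (root T, v) \<in> adj T ^^ n}"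
  have sub: "adj T \<subseteq> verts T \<times> verts T" and r: "root T \<in> verts T"
    and fin: "\<And>v. v \<in> verts T \<Longrightarrow> finite {w. (v, w) \<in> adj T}"
    and conn: "\<And>v. v \<in> verts T \<Longrightarrow> (root T, v) \<in> (adj T)\<^sup>*"
    using T by (auto simp: locally_finite_rooted_tree_def rooted_tree_def)
  have B: "finite (?B n) \<and> ?B n \<subseteq> verts T" for n
  proof (induction n)
    case 0
    then show ?case using r by auto
  next
    case (Suc n)
    have "?B (Suc n) = (\<Union>v \<in> ?B n. {w. (v, w) \<in> adj T})"
      by (auto simp: relcomp_unfold)
    moreover have "finite (\<Union>v \<in> ?B n. {w. (v, w) \<in> adj T})"
      using Suc fin by (intro finite_UN_I) auto
    ultimately show ?case using sub by auto
  qed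
  have "verts T \<subseteq> (\<Union>n. ?B n)"
    using conn by (auto simp: rtrancl_power)
  moreover have "countable (\<Union>n. ?B n)"
    using B by (intro countable_UN) (auto intro: countable_finite)
  ultimately show ?thesis by (rule countable_subset)
qed

end

theory Submission
  imports Defs
begin

text \<open>Hang the finite quotient \<open>G / N\<close>, as a set of leaves, on the \<open>k\<close>-th vertex of a ray, where
  \<open>N\<close> is the \<open>k\<close>-th open normal subgroup in some enumeration. Every isometry of this tree fixes
  the ray, so the isometry type of \<open>g\<close> determines which \<open>N\<close> contain \<open>g\<close>. If every nonempty open
  set were split by some \<open>N\<close>, a Cantor scheme would give continuum many types. Hence there are \<open>g\<close>
  and an open normal \<open>M\<close> such that the elements of \<open>M g\<close> lie in the same \<open>N\<close>, and then \<open>M\<close> lies in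
  every \<open>N\<close> that contains \<open>g\<close>. So no proper open normal subgroup contains \<open>g\<close> together with
  representatives of \<open>G / M\<close>; as proper subgroups of a nilpotent group lie in proper normal
  subgroups, these finitely many elements generate \<open>G\<close> topologically.

  If \<open>d\<close> elements generate a nilpotent group of class \<open>c\<close>, its lower central factors are generated
  by \<open>d, d\<^sup>2, \<dots>, d\<^sup>c\<close> elements, so every subgroup is generated by \<open>d + \<dots> + d\<^sup>c\<close> elements. This bound
  is uniform over the finite quotients of \<open>G\<close> and passes to closed subgroups by compactness.\<close>

section \<open>Normal subgroups and the lower central series\<close>

context group
begin

lemma inv_cancel:
  assumes "x \<in> carrier G" "y \<in> carrier G"
  shows "inv x \<otimes> (x \<otimes> y) = y" "x \<otimes> (inv x \<otimes> y) = y"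
  using assms by (simp_all flip: m_assoc)

text \<open>Conjugation is multiplicative, so conjugates of words are words in conjugates of
  generators. These conjugates need only lie in the generated subgroup, not in \<open>K\<close>
  again, and the commutator arguments below provide exactly that.\<close>

lemma normal_generateI':
  assumes "K \<subseteq> carrier G"
    and "\<And>k g. k \<in> K \<Longrightarrow> g \<in> carrier G \<Longrightarrow> g \<otimes> k \<otimes> inv g \<in> generate G K"
  shows "generate G K \<lhd> G"
proof (rule normal_invI)
  show sub: "subgroup (generate G K) G"
    by (rule generate_is_subgroup[OF assms(1)])
  fix g h assume g: "g \<in> carrier G" and "h \<in> generate G K"
  from this(2) show "g \<otimes> h \<otimes> inv g \<in> generate G K"
  proof (induction rule: generate.induct)
    case one
    show ?case using g by (simp add: generate.one)
  next
    case (incl h)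
    then show ?case using assms(2) g by blast
  next
    case (inv h)
    then have h: "h \<in> carrier G" using assms(1) by blast
    have "g \<otimes> inv h \<otimes> inv g = inv (g \<otimes> h \<otimes> inv g)"
      using g h by (simp add: inv_mult_group m_assoc)
    then show ?case
      using assms(2)[OF inv g] sub subgroup.m_inv_closed by force
  next
    case (eng h1 h2)
    have h: "h1 \<in> carrier G" "h2 \<in> carrier G"
      using eng generate_in_carrier[OF assms(1)] by auto
    have "g \<otimes> (h1 \<otimes> h2) \<otimes> inv g = (g \<otimes> h1 \<otimes> inv g) \<otimes> (g \<otimes> h2 \<otimes> inv g)"
      using g h by (simp add: m_assoc inv_cancel)
    then show ?case using eng generate.eng by metis
  qed
qed

text \<open>Products \<open>m \<otimes> y\<close> are closed under multiplication: moving
  \<open>y1\<close> past \<open>m2\<close> replaces \<open>m2\<close> by a conjugate, which stays in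
  \<open>N\<close>.\<close>

lemma generate_Un_normal:
  assumes "N \<lhd> G" "T \<subseteq> carrier G" "x \<in> generate G (T \<union> N)"
  obtains m y where "m \<in> N" "y \<in> generate G T" "x = m \<otimes> y"
proof -
  interpret N: normal N G by fact
  have T: "subgroup (generate G T) G" by (rule generate_is_subgroup[OF assms(2)])
  have Tc: "t \<in> carrier G" if "t \<in> generate G T" for t
    using that generate_in_carrier[OF assms(2)] by blast
  from assms(3) have "\<exists>m\<in>N. \<exists>y\<in>generate G T. x = m \<otimes> y"
  proof (induction rule: generate.induct)
    case one
    show ?case using N.one_closed generate.one[of G T] l_one[OF one_closed] by metis
  next
    case (incl h)
    then show ?case
    proof
      assume h: "h \<in> T"
      then have "h = \<one> \<otimes> h" using assms(2) by auto
      with h show ?thesis using N.one_closed generate.incl by metis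
    next
      assume h: "h \<in> N"
      then have "h = h \<otimes> \<one>" by simp
      with h show ?thesis using generate.one by metis
    qed
  next
    case (inv h)
    then show ?case
    proof
      assume h: "h \<in> T"
      then have "inv h = \<one> \<otimes> inv h" using assms(2) by auto
      with h show ?thesis using N.one_closed generate.inv by metis
    next
      assume h: "h \<in> N"
      then have "inv h = inv h \<otimes> \<one>" by simp
      with h show ?thesis using generate.one N.m_inv_closed by metis
    qed
  next
    case (eng h1 h2)
    then obtain m1 y1 m2 y2 where *: "m1 \<in> N" "m2 \<in> N" "y1 \<in> generate G T" "y2 \<in> generate G T"
      "h1 = m1 \<otimes> y1" "h2 = m2 \<otimes> y2" by blast
    then have c: "m1 \<in> carrier G" "m2 \<in> carrier G" "y1 \<in> carrier G" "y2 \<in> carrier G"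
      using Tc by auto
    have "h1 \<otimes> h2 = (m1 \<otimes> (y1 \<otimes> m2 \<otimes> inv y1)) \<otimes> (y1 \<otimes> y2)"
      unfolding * using c by (simp add: m_assoc inv_cancel)
    moreover have "m1 \<otimes> (y1 \<otimes> m2 \<otimes> inv y1) \<in> N"
      using * c N.inv_op_closed2 by simp
    ultimately show ?case using * generate.eng by metis
  qed
  then show thesis using that by blast
qed

section \<open>The lower central series and proper subgroups of nilpotent groups\<close>

lemma lower_central_series_normal: "lower_central_series G n \<lhd> G"
proof (induction n)
  case 0
  show ?case by (simp add: normal_self)
next
  case (Suc n)
  interpret L: normal "lower_central_series G n" G by fact
  show ?case
    unfolding lower_central_series.simps
  proof (rule normal_generateI)
    fix k x
    assume "k \<in> (\<Union>h\<in>lower_central_series G n. \<Union>g\<in>carrier G. {h \<otimes> g \<otimes> inv h \<otimes> inv g})"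
      and x: "x \<in> carrier G"
    then obtain h g where h: "h \<in> lower_central_series G n" and g: "g \<in> carrier G"
      and k: "k = h \<otimes> g \<otimes> inv h \<otimes> inv g" by blast
    have hc: "h \<in> carrier G" using h by simp
    \<comment> \<open>Conjugation carries a commutator to the commutator of the conjugates.\<close>
    have "x \<otimes> k \<otimes> inv x = (x \<otimes> h \<otimes> inv x) \<otimes> (x \<otimes> g \<otimes> inv x) \<otimes> inv (x \<otimes> h \<otimes> inv x) \<otimes> inv (x \<otimes> g \<otimes> inv x)"
      unfolding k using x hc g by (simp add: m_assoc inv_mult_group inv_cancel)
    moreover have "x \<otimes> h \<otimes> inv x \<in> lower_central_series G n"
      using L.inv_op_closed2 x h by blast
    moreover have "x \<otimes> g \<otimes> inv x \<in> carrier G" using x g by simp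
    ultimately show "x \<otimes> k \<otimes> inv x \<in>
       (\<Union>h\<in>lower_central_series G n. \<Union>g\<in>carrier G. {h \<otimes> g \<otimes> inv h \<otimes> inv g})"
      by blast
  qed auto
qed

lemma commutator_in_lower_central_series:
  assumes "h \<in> lower_central_series G n" "g \<in> carrier G"
  shows "h \<otimes> g \<otimes> inv h \<otimes> inv g \<in> lower_central_series G (Suc n)"
  using assms by (auto intro: generate.incl)

text \<open>Joining \<open>H\<close> with the terms of the lower central series gives a chain from
  the whole group down to \<open>H\<close>. Where this chain drops below the whole group, the new
  term is proper, and it is normal because conjugation moves elements of \<open>H\<close> only by
  elements of \<open>H\<close> and commutators in that term.\<close>

lemma nilpotent_proper_subgroup_in_proper_normal:
  assumes nil: "lower_central_series G c = {\<one>}"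
    and H: "subgroup H G" "H \<noteq> carrier G"
  obtains N where "N \<lhd> G" "H \<subseteq> N" "N \<noteq> carrier G"
proof -
  let ?C = "\<lambda>i. generate G (H \<union> lower_central_series G i)"
  have Hc: "H \<subseteq> carrier G" using H(1) subgroup.subset by blast
  have Lc: "lower_central_series G i \<subseteq> carrier G" for i
    using lower_central_series_normal normal_imp_subgroup subgroup.subset by blast
  have "?C 0 = carrier G"
    using Hc generate_incl[of "carrier G"] by (auto simp: sup.absorb2 intro: generate.incl)
  moreover have "H \<union> {\<one>} = H" using subgroup.one_closed[OF H(1)] by blast
  then have "?C c = H"
    using generate_subgroup_incl[of H H] H(1) nil by (auto intro: generate.incl)
  \<comment> \<open>Otherwise \<open>?C i = carrier G\<close> would persist up to
    \<open>i = c\<close>, forcing \<open>H\<close> to be the whole group.\<close>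
  ultimately have "\<exists>i. ?C i = carrier G \<and> ?C (Suc i) \<noteq> carrier G"
    using H(2) nat_induct[of "\<lambda>i. ?C i = carrier G" c] by auto
  then obtain i where i: "?C i = carrier G" "?C (Suc i) \<noteq> carrier G" by blast
  have "?C (Suc i) \<lhd> G"
  proof (rule normal_generateI')
    show "H \<union> lower_central_series G (Suc i) \<subseteq> carrier G" using Hc Lc by blast
    fix k g assume k: "k \<in> H \<union> lower_central_series G (Suc i)" and g: "g \<in> carrier G"
    show "g \<otimes> k \<otimes> inv g \<in> ?C (Suc i)"
    proof (cases "k \<in> lower_central_series G (Suc i)")
      case True
      then show ?thesis
        using normal.inv_op_closed2[OF lower_central_series_normal g] generate.incl by (metis UnCI)
    next
      case False
      with k have k: "k \<in> H" by blast
      have "g \<in> ?C i" using g i by simp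
      then obtain x h where x: "x \<in> lower_central_series G i" and h: "h \<in> generate G H" "g = x \<otimes> h"
        using generate_Un_normal[OF lower_central_series_normal Hc] by metis
      have hH: "h \<in> H" using h H(1) generate_subgroup_incl by blast
      let ?k = "h \<otimes> k \<otimes> inv h"
      have kH: "?k \<in> H" using H(1) k hH by (simp add: subgroup.m_closed subgroup.m_inv_closed)
      have c: "x \<in> carrier G" "h \<in> carrier G" "k \<in> carrier G" using x Lc hH k Hc by blast+
      \<comment> \<open>Conjugation by \<open>h\<close> stays inside \<open>H\<close>; the remaining
        conjugation by \<open>x\<close> costs one commutator, which lies in the next term of the
        series.\<close>
      have "g \<otimes> k \<otimes> inv g = (x \<otimes> ?k \<otimes> inv x \<otimes> inv ?k) \<otimes> ?k"
        unfolding h using c by (simp add: m_assoc inv_mult_group inv_cancel)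
      moreover have "x \<otimes> ?k \<otimes> inv x \<otimes> inv ?k \<in> ?C (Suc i)"
        by (rule generate.incl[OF UnI2[OF commutator_in_lower_central_series[OF x]]])
          (use kH Hc in blast)
      moreover have "?k \<in> ?C (Suc i)" using kH by (simp add: generate.incl)
      ultimately show ?thesis using generate.eng by metis
    qed
  qed
  moreover have "H \<subseteq> ?C (Suc i)" by (auto intro: generate.incl)
  ultimately show thesis using that i(2) by blast
qed

end

section \<open>Subgroups of finitely generated nilpotent groups\<close>

text \<open>Division with remainder by the least positive element, or by 0 if there is none. It will
  be applied to the exponents of powers of an element that meet a given subgroup modulo a normal
  one.\<close>

lemma int_minus_closed_principal:
  fixes Z :: "int set"
  assumes "0 \<in> Z" and diff: "\<And>a b. a \<in> Z \<Longrightarrow> b \<in> Z \<Longrightarrow> a - b \<in> Z"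
  obtains d where "d \<in> Z" "\<And>k. k \<in> Z \<Longrightarrow> d dvd k"
proof (cases "\<exists>k\<in>Z. k > 0")
  case False
  have "k = 0" if "k \<in> Z" for k
  proof -
    have "- k \<in> Z" using diff[OF assms(1) that] by simp
    then have "\<not> k > 0" "\<not> - k > 0" using False that by blast+
    then show ?thesis by simp
  qed
  then show thesis using that[OF assms(1)] by auto
next
  case True
  define d where "d = (LEAST n::nat. n > 0 \<and> int n \<in> Z)"
  have "\<exists>n::nat. n > 0 \<and> int n \<in> Z" using True by (metis zero_less_imp_eq_int)
  then have d: "d > 0" "int d \<in> Z" unfolding d_def by (metis (mono_tags, lifting) LeastI)+
  have add: "a + b \<in> Z" if "a \<in> Z" "b \<in> Z" for a b
    using diff[OF that(1) diff[OF assms(1) that(2)]] by simp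
  have mult: "int n * int d \<in> Z" for n
    by (induction n) (use assms(1) add d in \<open>auto simp: algebra_simps\<close>)
  have mult': "q * int d \<in> Z" for q
  proof (cases "q \<ge> 0")
    case True
    then show ?thesis using mult[of "nat q"] by simp
  next
    case False
    then show ?thesis using diff[OF assms(1) mult[of "nat (- q)"]] by simp
  qed
  have "int d dvd k" if "k \<in> Z" for k
  proof (rule ccontr)
    assume "\<not> int d dvd k"
    then have "k mod int d > 0" using d(1)
      by (metis dvd_eq_mod_eq_0 of_nat_0_less_iff pos_mod_sign order_le_less)
    moreover have "k mod int d \<in> Z"
      using diff[OF that mult'[of "k div int d"]] by (simp add: minus_div_mult_eq_mod)
    moreover have "k mod int d < int d" using d(1) by simp
    ultimately have "nat (k mod int d) > 0 \<and> int (nat (k mod int d)) \<in> Z" "nat (k mod int d) < d" by auto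
    then show False using not_less_Least unfolding d_def by blast
  qed
  then show thesis using that d(2) by blast
qed

context group
begin

text \<open>A rank bound relative to \<open>M\<close>: for \<open>C = carrier G\<close> it says that
  the image in \<open>G / M\<close> of every subgroup needs at most \<open>L\<close> generators.
  Smaller \<open>C\<close> allow induction along a series. Lists of exact length \<open>L\<close>
  may repeat entries, which makes the bounds additive and later turns generating lists into points
  of one fixed product space.\<close>

definition generates_traces :: "'a set \<Rightarrow> 'a set \<Rightarrow> nat \<Rightarrow> bool" where
  "generates_traces M C L \<longleftrightarrow>
     (\<forall>H. subgroup H G \<longrightarrow>
        (\<exists>ts. length ts = L \<and> set ts \<subseteq> H \<and> H \<inter> C \<subseteq> generate G (set ts \<union> M)))"

lemma generates_traces_mono:
  "generates_traces M C L \<Longrightarrow> C' \<subseteq> C \<Longrightarrow> generates_traces M C' L"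
  unfolding generates_traces_def by (meson inf_mono order_refl subset_trans)

text \<open>Subgroups of cyclic groups are cyclic. The powers of \<open>s\<close> that agree modulo
  \<open>B\<close> with an element of \<open>H\<close> have exponents forming a subgroup of the
  integers; one \<open>h\<close> in \<open>H\<close> lying over its generator \<open>d\<close>
  accounts for everything outside \<open>B\<close>, and \<open>L\<close> further elements handle
  \<open>H \<inter> B\<close>.\<close>

lemma generates_traces_insert:
  assumes B: "B \<lhd> G" and s: "s \<in> carrier G" and M: "M \<subseteq> carrier G"
    and L: "generates_traces M B L"
  shows "generates_traces M (generate G (insert s B)) (Suc L)"
  unfolding generates_traces_def
proof (intro allI impI)
  fix H assume H: "subgroup H G"
  interpret B: normal B G by fact
  interpret H: subgroup H G by fact
  have hom: "group_hom G (G Mod B) (\<lambda>a. B #> a)"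
    using B.r_coset_hom_Mod B.factorgroup_is_group by (simp add: group_hom_def group_hom_axioms_def)
  interpret q: group_hom G "G Mod B" "\<lambda>a. B #> a" by (rule hom)
  define Z where "Z = {k::int. \<exists>x\<in>H. B #> x = B #> (s [^] k)}"
  have "0 \<in> Z" unfolding Z_def using H.one_closed int_pow_0 by (metis (mono_tags, lifting) mem_Collect_eq)
  moreover have "a - b \<in> Z" if ab: "a \<in> Z" "b \<in> Z" for a b
  proof -
    obtain x y where x: "x \<in> H" "B #> x = B #> (s [^] a)" and y: "y \<in> H" "B #> y = B #> (s [^] b)"
      using ab unfolding Z_def by blast
    have "B #> (x \<otimes> inv y) = B #> (s [^] a \<otimes> inv (s [^] b))"
      using x y s by (simp del: B.rcos_inv)
    then have "B #> (x \<otimes> inv y) = B #> (s [^] (a - b))"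
      using s by (simp only: int_pow_diff)
    moreover have "x \<otimes> inv y \<in> H" using x y by simp
    ultimately show ?thesis unfolding Z_def by blast
  qed
  ultimately obtain d where d: "d \<in> Z" "\<And>k. k \<in> Z \<Longrightarrow> d dvd k"
    using int_minus_closed_principal by blast
  obtain h where h: "h \<in> H" "B #> h = B #> (s [^] d)" using d(1) unfolding Z_def by blast
  obtain ts where ts: "length ts = L" "set ts \<subseteq> H" "H \<inter> B \<subseteq> generate G (set ts \<union> M)"
    using L H unfolding generates_traces_def by blast
  let ?K = "generate G (set (h # ts) \<union> M)"
  have K: "subgroup ?K G"
    by (rule generate_is_subgroup) (use M ts(2) h(1) H.subset in auto)
  have "H \<inter> generate G (insert s B) \<subseteq> ?K"
  proof
    fix x assume x: "x \<in> H \<inter> generate G (insert s B)"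
    then obtain m y where m: "m \<in> B" "y \<in> generate G {s}" "x = m \<otimes> y"
      using generate_Un_normal[OF B, of "{s}" x] s by auto
    obtain k :: int where k: "y = s [^] k" using m(2) generate_pow[OF s] by auto
    have "B #> x = B #> (s [^] k)"
      using m k s B.rcos_const by (simp add: coset_mult_assoc[symmetric] B.subset)
    then have "k \<in> Z" using x unfolding Z_def by blast
    then obtain p where p: "k = d * p" using d(2) by (meson dvdE)
    have hc: "h \<in> carrier G" using h by simp
    have "B #> (h [^] p) = (B #> h) [^]\<^bsub>G Mod B\<^esub> p" using hc q.hom_int_pow by blast
    also have "\<dots> = B #> ((s [^] d) [^] p)" using h s q.hom_int_pow[of "s [^] d"] by simp
    also have "\<dots> = B #> x" using \<open>B #> x = _\<close> p s by (simp add: int_pow_pow mult.commute)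
    finally have "B #> (h [^] p) = B #> x" .
    \<comment> \<open>As \<open>x\<close> and \<open>h [^] p\<close> agree modulo \<open>B\<close>
      and both lie in \<open>H\<close>, their quotient falls into \<open>H \<inter> B\<close>, where
      \<open>ts\<close> suffices.\<close>
    then have "x \<in> B #> (h [^] p)" using x rcos_self[OF _ B.subgroup_axioms] by auto
    then have "x \<otimes> inv (h [^] p) \<in> B" using B.rcos_module_imp[OF _ int_pow_closed[OF hc]] is_group by auto
    moreover have hp: "h [^] p \<in> H" using h(1) H by (simp add: subgroup_int_pow_closed)
    then have "x \<otimes> inv (h [^] p) \<in> H" using x by auto
    ultimately have "x \<otimes> inv (h [^] p) \<in> generate G (set ts \<union> M)" using ts by blast
    then have 1: "x \<otimes> inv (h [^] p) \<in> ?K" using mono_generate[of "set ts \<union> M" "set (h # ts) \<union> M"] by auto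
    have "h \<in> ?K" by (auto intro: generate.incl)
    then have 2: "h [^] p \<in> ?K" using K by (simp add: subgroup_int_pow_closed)
    have "x = (x \<otimes> inv (h [^] p)) \<otimes> h [^] p" using x hc by (simp add: m_assoc)
    then show "x \<in> ?K" using subgroup.m_closed[OF K 1 2] by simp
  qed
  then show "\<exists>ts. length ts = Suc L \<and> set ts \<subseteq> H \<and> H \<inter> generate G (insert s B) \<subseteq> generate G (set ts \<union> M)"
    using ts h by (intro exI[of _ "h # ts"]) auto
qed

text \<open>Elements central modulo \<open>B\<close> differ from their conjugates by elements of
  \<open>B\<close>.\<close>

lemma normal_generate_central_extension:
  assumes B: "B \<lhd> G" and S: "S \<subseteq> carrier G"
    and c: "\<And>s g. s \<in> S \<Longrightarrow> g \<in> carrier G \<Longrightarrow> s \<otimes> g \<otimes> inv s \<otimes> inv g \<in> B"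
  shows "generate G (S \<union> B) \<lhd> G"
proof (rule normal_generateI')
  interpret B: normal B G by fact
  show "S \<union> B \<subseteq> carrier G" using S B.subset by blast
  fix k g assume k: "k \<in> S \<union> B" and g: "g \<in> carrier G"
  show "g \<otimes> k \<otimes> inv g \<in> generate G (S \<union> B)"
  proof (cases "k \<in> B")
    case True
    then show ?thesis using B.inv_op_closed2[OF g] generate.incl by (metis UnCI)
  next
    case False
    with k have k: "k \<in> S" "k \<in> carrier G" using S by auto
    have "inv (k \<otimes> g \<otimes> inv k \<otimes> inv g) \<in> B" using c[OF k(1) g] by simp
    moreover have "inv (k \<otimes> g \<otimes> inv k \<otimes> inv g) \<otimes> k = g \<otimes> k \<otimes> inv g"
      using k g by (simp add: inv_mult_group m_assoc inv_cancel)
    ultimately show ?thesis using k(1) generate.incl generate.eng by (metis UnCI)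
  qed
qed

text \<open>The elements of \<open>ss\<close> are adjoined to \<open>B\<close> one at a time. Their
  centrality modulo \<open>B\<close> keeps every intermediate subgroup normal, so each costs just
  one generator.\<close>

lemma generates_traces_central_extension:
  assumes B: "B \<lhd> G" and M: "M \<subseteq> carrier G" and L: "generates_traces M B L"
    and "set ss \<subseteq> carrier G"
    and "\<And>s g. s \<in> set ss \<Longrightarrow> g \<in> carrier G \<Longrightarrow> s \<otimes> g \<otimes> inv s \<otimes> inv g \<in> B"
  shows "generates_traces M (generate G (set ss \<union> B)) (length ss + L)"
  using assms(4,5)
proof (induction ss)
  case Nil
  have "generate G B = B"
    using B normal_imp_subgroup generate_subgroup_incl[of B B] by (auto intro: generate.incl)
  then show ?case using L by simp
next
  case (Cons s ss)
  let ?B = "generate G (set ss \<union> B)"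
  have N: "?B \<lhd> G" using normal_generate_central_extension[OF B] Cons.prems by simp
  have "generates_traces M ?B (length ss + L)" using Cons by simp
  from generates_traces_insert[OF N _ M this, of s]
  have "generates_traces M (generate G (insert s ?B)) (Suc (length ss + L))" using Cons.prems by simp
  moreover have "generate G (set (s # ss) \<union> B) \<subseteq> generate G (insert s ?B)"
    by (intro mono_generate) (auto intro: generate.incl)
  ultimately show ?case using generates_traces_mono by simp
qed

section \<open>Generators of the lower central factors\<close>

lemma subgroup_commuting_mod_normal:
  assumes D: "D \<lhd> G" and g: "g \<in> carrier G"
  shows "subgroup {x \<in> carrier G. x \<otimes> g \<otimes> inv x \<otimes> inv g \<in> D} G"
proof (rule subgroupI)
  interpret D: normal D G by fact
  have "\<one> \<otimes> g \<otimes> inv \<one> \<otimes> inv g \<in> D" using g by simp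
  then show "{x \<in> carrier G. x \<otimes> g \<otimes> inv x \<otimes> inv g \<in> D} \<noteq> {}" by blast
  fix a assume "a \<in> {x \<in> carrier G. x \<otimes> g \<otimes> inv x \<otimes> inv g \<in> D}"
  then have a: "a \<in> carrier G" "a \<otimes> g \<otimes> inv a \<otimes> inv g \<in> D" by auto
  have "inv a \<otimes> inv (a \<otimes> g \<otimes> inv a \<otimes> inv g) \<otimes> a \<in> D"
    using a D.inv_op_closed1 by simp
  moreover have "inv a \<otimes> inv (a \<otimes> g \<otimes> inv a \<otimes> inv g) \<otimes> a = inv a \<otimes> g \<otimes> inv (inv a) \<otimes> inv g"
    using a g by (simp add: inv_mult_group m_assoc inv_cancel)
  ultimately show "inv a \<in> {x \<in> carrier G. x \<otimes> g \<otimes> inv x \<otimes> inv g \<in> D}"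
    using a by simp
  fix b assume "b \<in> {x \<in> carrier G. x \<otimes> g \<otimes> inv x \<otimes> inv g \<in> D}"
  then have b: "b \<in> carrier G" "b \<otimes> g \<otimes> inv b \<otimes> inv g \<in> D" by auto
  \<comment> \<open>The set is the preimage of the centralizer of the image of \<open>g\<close> in
    \<open>G / D\<close>. Closure under products is the identity
    \<open>[a b, g] = (a [b, g] inv a) [a, g]\<close>.\<close>
  have "a \<otimes> (b \<otimes> g \<otimes> inv b \<otimes> inv g) \<otimes> inv a \<otimes> (a \<otimes> g \<otimes> inv a \<otimes> inv g) \<in> D"
    using a b D.inv_op_closed2 by simp
  moreover have "a \<otimes> (b \<otimes> g \<otimes> inv b \<otimes> inv g) \<otimes> inv a \<otimes> (a \<otimes> g \<otimes> inv a \<otimes> inv g)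
      = (a \<otimes> b) \<otimes> g \<otimes> inv (a \<otimes> b) \<otimes> inv g"
    using a(1) b(1) g by (simp add: inv_mult_group m_assoc inv_cancel)
  ultimately show "a \<otimes> b \<in> {x \<in> carrier G. x \<otimes> g \<otimes> inv x \<otimes> inv g \<in> D}"
    using a b by simp
qed blast

lemma commutator_swap:
  assumes "D \<lhd> G" "x \<in> carrier G" "g \<in> carrier G" "x \<otimes> g \<otimes> inv x \<otimes> inv g \<in> D"
  shows "g \<otimes> x \<otimes> inv g \<otimes> inv x \<in> D"
proof -
  interpret D: normal D G by fact
  have "inv (x \<otimes> g \<otimes> inv x \<otimes> inv g) \<in> D" using assms by simp
  then show ?thesis using assms by (simp add: inv_mult_group m_assoc)
qed

text \<open>Left-normed commutators of weight \<open>i + 1\<close> in the entries of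
  \<open>ss\<close>; the index is aligned with \<open>lower_central_series\<close>, which also
  starts at 0.\<close>

primrec iterated_commutators :: "'a list \<Rightarrow> nat \<Rightarrow> 'a list" where
  "iterated_commutators ss 0 = ss"
| "iterated_commutators ss (Suc i) =
     [x \<otimes> s \<otimes> inv x \<otimes> inv s. x \<leftarrow> iterated_commutators ss i, s \<leftarrow> ss]"

lemma length_iterated_commutators: "length (iterated_commutators ss i) = length ss ^ Suc i"
  by (induction i) (simp_all add: length_concat comp_def sum_list_triv)

lemma iterated_commutators_subset:
  assumes "set ss \<subseteq> carrier G"
  shows "set (iterated_commutators ss i) \<subseteq> lower_central_series G i"
proof (induction i)
  case (Suc i)
  show ?case
  proof
    fix y assume "y \<in> set (iterated_commutators ss (Suc i))"
    then obtain x s where "x \<in> set (iterated_commutators ss i)" "s \<in> set ss"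
      and "y = x \<otimes> s \<otimes> inv x \<otimes> inv s" by auto
    then show "y \<in> lower_central_series G (Suc i)"
      using commutator_in_lower_central_series[of x i s] Suc assms by blast
  qed
qed (use assms in simp)

lemma lower_central_series_Un_normal:
  assumes "M \<lhd> G"
  shows "generate G (lower_central_series G i \<union> M) \<lhd> G"
proof (rule normal_generateI')
  interpret M: normal M G by fact
  interpret L: normal "lower_central_series G i" G by (rule lower_central_series_normal)
  show "lower_central_series G i \<union> M \<subseteq> carrier G" using L.subset M.subset by blast
  show "g \<otimes> k \<otimes> inv g \<in> generate G (lower_central_series G i \<union> M)"
    if "k \<in> lower_central_series G i \<union> M" "g \<in> carrier G" for k g
    using that L.inv_op_closed2 M.inv_op_closed2 by (intro generate.incl) blast
qed

text \<open>Modulo \<open>M\<close> and the next term of the series, left-normed commutators of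
  generators suffice. In the inductive step it is enough that all commutators of the
  \<open>i\<close>-th term with group elements vanish modulo \<open>?D\<close>; this is reduced to
  generators first in the right argument, then in the left one.\<close>

lemma lower_central_series_generated:
  assumes ss: "set ss \<subseteq> carrier G" and M: "M \<lhd> G"
    and gen: "generate G (set ss \<union> M) = carrier G"
  shows "lower_central_series G i \<subseteq>
    generate G (set (iterated_commutators ss i) \<union> generate G (lower_central_series G (Suc i) \<union> M))"
proof (induction i)
  case 0
  have "generate G (set ss \<union> M) \<subseteq> generate G (set ss \<union> generate G (lower_central_series G (Suc 0) \<union> M))"
    by (intro mono_generate) (auto intro: generate.incl)
  then show ?case using gen by simp
next
  case (Suc i)
  interpret M: normal M G by fact
  let ?L = "lower_central_series G"
  let ?S = "\<lambda>i. set (iterated_commutators ss i)"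
  let ?B = "generate G (?L (Suc (Suc i)) \<union> M)"
  let ?D = "generate G (?S (Suc i) \<union> ?B)"
  have Lc: "?L j \<subseteq> carrier G" for j
    using lower_central_series_normal normal_imp_subgroup subgroup.subset by blast
  have Sc: "?S j \<subseteq> carrier G" for j
    using iterated_commutators_subset[OF ss] Lc by blast
  have LB: "?L (Suc (Suc i)) \<subseteq> ?B" and MB: "M \<subseteq> ?B" by (auto intro: generate.incl)
  have BD: "?B \<subseteq> ?D" and SD: "?S (Suc i) \<subseteq> ?D" by (auto intro: generate.incl)
  have D: "?D \<lhd> G"
  proof (rule normal_generate_central_extension[OF lower_central_series_Un_normal[OF M] Sc])
    fix s g assume "s \<in> ?S (Suc i)" "g \<in> carrier G"
    then show "s \<otimes> g \<otimes> inv s \<otimes> inv g \<in> ?B"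
      using iterated_commutators_subset[OF ss, of "Suc i"] LB
        commutator_in_lower_central_series[of s "Suc i" g] by blast
  qed
  have MD: "m \<otimes> g \<otimes> inv m \<otimes> inv g \<in> ?D" if "m \<in> M" "g \<in> carrier G" for m g
  proof -
    have "m \<otimes> (g \<otimes> inv m \<otimes> inv g) \<in> M" using that M.m_closed[OF _ M.inv_op_closed2[OF _ M.m_inv_closed]] by blast
    then have "m \<otimes> g \<otimes> inv m \<otimes> inv g \<in> M" using that M.mem_carrier[of m] by (simp add: m_assoc)
    then show ?thesis using MB BD by blast
  qed
  \<comment> \<open>Right argument: what commutes with \<open>x\<close> modulo \<open>?D\<close> is
    a subgroup containing \<open>ss\<close> and \<open>M\<close>, hence everything.\<close>
  have 1: "x \<otimes> g \<otimes> inv x \<otimes> inv g \<in> ?D" if x: "x \<in> ?S i" and g: "g \<in> carrier G" for x g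
  proof -
    have xc: "x \<in> carrier G" using x Sc by blast
    let ?Z = "{g \<in> carrier G. g \<otimes> x \<otimes> inv g \<otimes> inv x \<in> ?D}"
    have "set ss \<subseteq> ?Z"
    proof
      fix s assume s: "s \<in> set ss"
      then have sc: "s \<in> carrier G" using ss by blast
      have "x \<otimes> s \<otimes> inv x \<otimes> inv s \<in> ?S (Suc i)" using x s by auto
      then show "s \<in> ?Z" using commutator_swap[OF D xc sc] SD sc by blast
    qed
    moreover have "M \<subseteq> ?Z" using MD xc by auto
    ultimately have "generate G (set ss \<union> M) \<subseteq> ?Z"
      by (intro generate_subgroup_incl subgroup_commuting_mod_normal[OF D xc]) blast
    then show ?thesis using gen g commutator_swap[OF D g xc] by blast
  qed
  \<comment> \<open>Left argument: what commutes with \<open>g\<close> modulo \<open>?D\<close> is a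
    subgroup containing the iterated commutators, the next term and \<open>M\<close>, hence by the
    induction hypothesis the whole \<open>i\<close>-th term.\<close>
  have 2: "h \<otimes> g \<otimes> inv h \<otimes> inv g \<in> ?D" if h: "h \<in> ?L i" and g: "g \<in> carrier G" for h g
  proof -
    let ?Z = "{x \<in> carrier G. x \<otimes> g \<otimes> inv x \<otimes> inv g \<in> ?D}"
    have Z: "subgroup ?Z G" by (rule subgroup_commuting_mod_normal[OF D g])
    have "?L (Suc i) \<subseteq> ?Z"
      using commutator_in_lower_central_series[OF _ g, of _ "Suc i"] Lc LB BD by blast
    moreover have "M \<subseteq> ?Z" using MD g by auto
    ultimately have "generate G (?L (Suc i) \<union> M) \<subseteq> ?Z"
      by (intro generate_subgroup_incl Z) blast
    moreover have "?S i \<subseteq> ?Z" using 1 g Sc by blast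
    ultimately have "generate G (?S i \<union> generate G (?L (Suc i) \<union> M)) \<subseteq> ?Z"
      by (intro generate_subgroup_incl Z) blast
    then show ?thesis using Suc.IH h by blast
  qed
  show ?case
    unfolding lower_central_series.simps(2)[of G i]
    by (rule generate_subgroup_incl[OF _ normal_imp_subgroup[OF D]]) (use 2 in blast)
qed

text \<open>Climbing from the trivial term at \<open>c\<close> to the whole group at 0, the factor
  at \<open>j\<close> contributes its \<open>length ss ^ Suc j\<close> commutators as generators.
  The resulting bound does not depend on \<open>M\<close>, so it is uniform over all finite
  quotients considered later.\<close>

lemma nilpotent_generates_traces:
  assumes nil: "lower_central_series G c = {\<one>}" and ss: "set ss \<subseteq> carrier G" and M: "M \<lhd> G"
    and gen: "generate G (set ss \<union> M) = carrier G"
  shows "generates_traces M (carrier G) (\<Sum>j<c. length ss ^ Suc j)"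
proof -
  interpret M: normal M G by fact
  have "generates_traces M (generate G (lower_central_series G i \<union> M)) (\<Sum>j=i..<c. length ss ^ Suc j)"
    if "i \<le> c" for i
    using that
  proof (induction i rule: inc_induct)
    case base
    have "generate G ({\<one>} \<union> M) \<subseteq> M"
      by (rule generate_subgroup_incl[OF _ M.subgroup_axioms]) auto
    moreover have "generates_traces M M 0"
      unfolding generates_traces_def by (auto intro: generate.incl)
    ultimately show ?case using nil generates_traces_mono by simp
  next
    case (step i)
    let ?B = "generate G (lower_central_series G (Suc i) \<union> M)"
    let ?cs = "iterated_commutators ss i"
    have "lower_central_series G i \<subseteq> carrier G"
      using lower_central_series_normal normal_imp_subgroup subgroup.subset by blast
    then have cs: "set ?cs \<subseteq> carrier G" using iterated_commutators_subset[OF ss] by blast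
    have "generates_traces M (generate G (set ?cs \<union> ?B)) (length ?cs + (\<Sum>j=Suc i..<c. length ss ^ Suc j))"
    proof (rule generates_traces_central_extension[OF lower_central_series_Un_normal[OF M] M.subset step.IH cs])
      fix s g assume "s \<in> set ?cs" "g \<in> carrier G"
      then show "s \<otimes> g \<otimes> inv s \<otimes> inv g \<in> ?B"
        using iterated_commutators_subset[OF ss, of i]
          commutator_in_lower_central_series[of s i g] by (intro generate.incl) blast
    qed
    moreover have "generate G (lower_central_series G i \<union> M) \<subseteq> generate G (set ?cs \<union> ?B)"
    proof (rule generate_subgroup_incl)
      have "?B \<subseteq> carrier G"
        using lower_central_series_Un_normal[OF M] normal_imp_subgroup subgroup.subset by blast
      then show "subgroup (generate G (set ?cs \<union> ?B)) G" using cs by (intro generate_is_subgroup) blast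
      show "lower_central_series G i \<union> M \<subseteq> generate G (set ?cs \<union> ?B)"
        using lower_central_series_generated[OF ss M gen, of i] by (auto intro: generate.incl)
    qed
    ultimately have "generates_traces M (generate G (lower_central_series G i \<union> M))
        (length ?cs + (\<Sum>j=Suc i..<c. length ss ^ Suc j))"
      by (rule generates_traces_mono)
    moreover have "length ?cs + (\<Sum>j=Suc i..<c. length ss ^ Suc j) = (\<Sum>j=i..<c. length ss ^ Suc j)"
      using step.hyps by (simp add: length_iterated_commutators sum.atLeast_Suc_lessThan)
    ultimately show ?case by simp
  qed
  from this[of 0] have "generates_traces M (generate G (carrier G \<union> M)) (\<Sum>j<c. length ss ^ Suc j)"
    by (simp add: lessThan_atLeast0)
  then show ?thesis by (rule generates_traces_mono) (auto intro: generate.incl)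
qed

end

section \<open>Groups filtered by open normal subgroups\<close>

text \<open>What is kept of an inverse limit of finite groups: the kernels \<open>M n\<close> of the
  projections, whose cosets form a base of the topology.\<close>

locale normal_filtration = group G for G (structure) +
  fixes X :: "'a topology" and M :: "nat \<Rightarrow> 'a set"
  assumes space: "topspace X = carrier G"
    and compact: "compact_space X"
    and normal: "M n \<lhd> G"
    and Suc_subset: "M (Suc n) \<subseteq> M n"
    and finite_index: "finite (rcosets (M n))"
    and coset_open: "x \<in> carrier G \<Longrightarrow> openin X (M n #> x)"
    and coset_base: "openin X U \<Longrightarrow> x \<in> U \<Longrightarrow> \<exists>n. M n #> x \<subseteq> U"
begin

section \<open>Unions of cosets, open normal subgroups and topological generation\<close>

lemma subgroup_filtration: "subgroup (M n) G"
  by (rule normal_imp_subgroup[OF normal])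

lemma filtration_carrier: "M n \<subseteq> carrier G"
  by (rule subgroup.subset[OF subgroup_filtration])

lemma openin_saturated:
  assumes "W \<subseteq> carrier G" "\<And>x. x \<in> W \<Longrightarrow> M n #> x \<subseteq> W"
  shows "openin X W"
proof (subst openin_subopen, intro ballI)
  fix x assume "x \<in> W"
  then show "\<exists>T. openin X T \<and> x \<in> T \<and> T \<subseteq> W"
    using assms coset_open[of x n] rcos_self[OF _ subgroup_filtration, of x n] by blast
qed

lemma closedin_saturated:
  assumes "W \<subseteq> carrier G" "\<And>x. x \<in> W \<Longrightarrow> M n #> x \<subseteq> W"
  shows "closedin X W"
  unfolding closedin_def space
proof
  show "openin X (carrier G - W)"
  proof (rule openin_saturated)
    fix x assume x: "x \<in> carrier G - W"
    show "M n #> x \<subseteq> carrier G - W"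
    proof
      fix y assume y: "y \<in> M n #> x"
      then have "M n #> x = M n #> y" using repr_independence[OF _ _ subgroup_filtration] x by blast
      moreover have "y \<in> carrier G" using y x r_coset_subset_G[OF filtration_carrier] by blast
      ultimately show "y \<in> carrier G - W"
        using x assms(2)[of y] rcos_self[OF _ subgroup_filtration, of x n] by blast
    qed
  qed blast
qed (rule assms(1))

text \<open>Justifies expressing openness of a normal subgroup by
  \<open>M n \<subseteq> N\<close>.\<close>

lemma normal_overgroup_clopen:
  assumes "N \<lhd> G" "M n \<subseteq> N"
  shows "openin X N" "closedin X N"
proof -
  have N: "subgroup N G" using assms(1) by (rule normal_imp_subgroup)
  have "M n #> x \<subseteq> N" if "x \<in> N" for x
    using that assms(2) subgroup.m_closed[OF N] unfolding r_coset_def by blast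
  then show "openin X N" "closedin X N"
    using openin_saturated closedin_saturated subgroup.subset[OF N] by blast+
qed

text \<open>The generators are \<open>g\<close> and representatives of the cosets of one
  \<open>M m\<close> with \<open>M m #> g \<subseteq> U\<close>. This finite set is chosen before
  \<open>n\<close>, so it works modulo every \<open>M n\<close>.\<close>

lemma topologically_finitely_generated:
  assumes nil: "lower_central_series G c = {\<one>}"
    and U: "openin X U" "g \<in> U"
    and same: "\<And>N n h. N \<lhd> G \<Longrightarrow> M n \<subseteq> N \<Longrightarrow> h \<in> U \<Longrightarrow> h \<in> N \<longleftrightarrow> g \<in> N"
  obtains ss where "set ss \<subseteq> carrier G" "\<And>n. generate G (set ss \<union> M n) = carrier G"
proof -
  have g: "g \<in> carrier G" using U openin_subset space by blast
  obtain m where m: "M m #> g \<subseteq> U" using coset_base U by blast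
  define R where "R = insert g ((\<lambda>C. SOME x. x \<in> C) ` (rcosets (M m)))"
  have rep: "(SOME x. x \<in> C) \<in> C" if "C \<in> rcosets (M m)" for C
    using that subgroup.rcosets_non_empty[OF subgroup_filtration] some_in_eq by blast
  have R: "finite R" "R \<subseteq> carrier G"
    using finite_index rep rcosets_part_G[OF subgroup_filtration] g unfolding R_def by blast+
  have gen: "generate G (R \<union> M n) = carrier G" for n
  proof (rule ccontr)
    assume ne: "generate G (R \<union> M n) \<noteq> carrier G"
    have "subgroup (generate G (R \<union> M n)) G"
      using R filtration_carrier by (intro generate_is_subgroup) blast
    from nilpotent_proper_subgroup_in_proper_normal[OF nil this ne]
    obtain N where N: "N \<lhd> G" "generate G (R \<union> M n) \<subseteq> N" "N \<noteq> carrier G" .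
    interpret N: subgroup N G using N(1) by (rule normal_imp_subgroup)
    have RN: "R \<subseteq> N" "M n \<subseteq> N" using N(2) generate.incl[of _ "R \<union> M n" G] by blast+
    have gN: "g \<in> N" using RN unfolding R_def by blast
    \<comment> \<open>Here \<open>U\<close> enters: \<open>N\<close> contains \<open>g\<close>,
      hence all of \<open>M m #> g\<close>, hence \<open>M m\<close> itself. With the
      representatives it then contains every coset of \<open>M m\<close>.\<close>
    have "k \<in> N" if k: "k \<in> M m" for k
    proof -
      have "k \<otimes> g \<in> U" using m k unfolding r_coset_def by blast
      then have "k \<otimes> g \<in> N" using same[OF N(1) RN(2)] gN by blast
      then have "k \<otimes> g \<otimes> inv g \<in> N" using gN by blast
      then show ?thesis using g k filtration_carrier[of m] by (simp add: m_assoc subset_iff)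
    qed
    have "x \<in> N" if x: "x \<in> carrier G" for x
    proof -
      have C: "M m #> x \<in> rcosets (M m)" using x rcosetsI[OF filtration_carrier] by blast
      let ?y = "SOME y. y \<in> M m #> x"
      have y: "?y \<in> M m #> x" "?y \<in> N" using rep[OF C] RN C unfolding R_def by blast+
      then obtain k where k: "k \<in> M m" "?y = k \<otimes> x" unfolding r_coset_def by blast
      then have "x = inv k \<otimes> ?y" using x filtration_carrier[of m] by (auto simp: inv_cancel)
      then show ?thesis using \<open>\<And>k. k \<in> M m \<Longrightarrow> k \<in> N\<close> k(1) y(2) N.m_closed N.m_inv_closed by metis
    qed
    then show False using N(3) N.subset by blast
  qed
  obtain ss where "set ss = R" using R(1) finite_list by blast
  then show thesis using that gen R(2) by blast
qed

text \<open>A binary tree of nonempty clopen sets: at stage \<open>k\<close> the current set is cut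
  by some \<open>N\<close>, and membership of \<open>k\<close> in \<open>A\<close> selects the half.
  Compactness provides a point on every branch.\<close>

lemma cantor_scheme:
  assumes N: "\<And>k. N k \<lhd> G" "\<And>k. \<exists>n. M n \<subseteq> N k"
    and split: "\<And>U. openin X U \<Longrightarrow> U \<noteq> {} \<Longrightarrow> \<exists>k. U \<inter> N k \<noteq> {} \<and> U - N k \<noteq> {}"
  obtains x :: "nat set \<Rightarrow> 'a"
    where "\<And>A. x A \<in> carrier G" "\<And>A B. A \<noteq> B \<Longrightarrow> \<exists>k. x A \<in> N k \<longleftrightarrow> x B \<notin> N k"
proof -
  \<comment> \<open>The cutting index depends only on the set, so branches with a common initial
    segment are cut by the same subgroup.\<close>
  obtain s where s: "\<And>U. openin X U \<Longrightarrow> U \<noteq> {} \<Longrightarrow> U \<inter> N (s U) \<noteq> {} \<and> U - N (s U) \<noteq> {}"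
    using split by metis
  define D where "D A = rec_nat (carrier G)
      (\<lambda>k U. if k \<in> A then U \<inter> N (s U) else U - N (s U))" for A :: "nat set"
  have D0: "D A 0 = carrier G"
    and DS: "D A (Suc k) = (if k \<in> A then D A k \<inter> N (s (D A k)) else D A k - N (s (D A k)))" for A k
    by (simp_all add: D_def)
  have clopen: "openin X (N k)" "closedin X (N k)" for k
    using N normal_overgroup_clopen by metis+
  have D: "openin X (D A k) \<and> closedin X (D A k) \<and> D A k \<noteq> {}" for A k
  proof (induction k)
    case 0
    show ?case unfolding D0 using space openin_topspace[of X] closedin_topspace[of X] one_closed by auto
  next
    case (Suc k)
    then show ?case using s[of "D A k"] clopen
      by (auto simp: DS intro: openin_Int closedin_Int openin_diff closedin_diff)
  qed
  have "decseq (D A)" for A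
    by (rule decseq_SucI) (auto simp: DS)
  then have "(\<Inter>k. D A k) \<noteq> {}" for A
    using compact_space_imp_nest[OF compact, of "D A"] D by blast
  then have "\<exists>x. \<forall>k. x \<in> D A k" for A by blast
  then obtain x where x: "\<And>A k. x A \<in> D A k" by metis
  have "\<exists>k. x A \<in> N k \<longleftrightarrow> x B \<notin> N k" if "A \<noteq> B" for A B
  proof -
    have "\<exists>k. k \<in> A \<longleftrightarrow> k \<notin> B" using that by blast
    \<comment> \<open>At the first difference of \<open>A\<close> and \<open>B\<close> both branches
      still sit in the same set and enter opposite halves.\<close>
    then obtain k where k: "k \<in> A \<longleftrightarrow> k \<notin> B" "\<And>j. j < k \<Longrightarrow> j \<in> A \<longleftrightarrow> j \<in> B"
      using exists_least_iff[of "\<lambda>k. k \<in> A \<longleftrightarrow> k \<notin> B"] by blast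
    have "D A j = D B j" if "j \<le> k" for j
      using that by (induction j) (auto simp: D0 DS k(2))
    from this[of k] show ?thesis using x[of A "Suc k"] x[of B "Suc k"] k(1) by (auto simp: DS split: if_splits)
  qed
  moreover have "x A \<in> carrier G" for A using x[of A 0] D0 by blast
  ultimately show thesis using that by blast
qed

text \<open>The \<open>L\<close>-tuples in \<open>H\<close> that generate \<open>H\<close> modulo
  \<open>M n\<close> form a nonempty closed subset of a compact power of \<open>H\<close>,
  decreasing in \<open>n\<close>. A tuple common to all of them generates a dense subgroup of
  \<open>H\<close>.\<close>

lemma closed_subgroup_generators:
  assumes H: "subgroup H G" "closedin X H"
    and L: "\<And>n. generates_traces (M n) (carrier G) L"
  shows "topological_generator_number G X H \<le> enat L"
proof -
  interpret H: subgroup H G by (rule H(1))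
  let ?P = "product_topology (\<lambda>_::nat. subtopology X H) {..<L}"
  let ?F = "\<lambda>n. {t \<in> {..<L} \<rightarrow>\<^sub>E H. H \<subseteq> generate G (t ` {..<L} \<union> M n)}"
  have tH: "topspace (subtopology X H) = H" using space H.subset by auto
  have car: "t ` {..<L} \<union> M n \<subseteq> carrier G" if "t \<in> {..<L} \<rightarrow>\<^sub>E H" for t n
    using that H.subset filtration_carrier by fastforce
  have comp: "compact_space ?P"
    using compact_space_subtopology[OF closedin_compact_space[OF compact H(2)]]
    by (simp add: compact_space_product_topology)
  have closed: "closedin ?P (?F n)" for n
    unfolding closedin_def topspace_product_topology tH
  proof
    show "openin ?P (({..<L} \<rightarrow>\<^sub>E H) - ?F n)"
    proof (subst openin_subopen, intro ballI)
      fix t assume t: "t \<in> ({..<L} \<rightarrow>\<^sub>E H) - ?F n"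
      \<comment> \<open>Multiplying the entries of \<open>t\<close> by elements of
        \<open>M n\<close> yields a tuple that, together with \<open>M n\<close>, generates no more
        than \<open>t\<close> does; so failure to generate persists on this box.\<close>
      let ?W = "Pi\<^sub>E {..<L} (\<lambda>i. H \<inter> (M n #> t i))"
      have tc: "t i \<in> carrier G" "t i \<in> H" if "i < L" for i
        using t that H.subset by (auto simp: PiE_iff)
      have "openin (subtopology X H) (H \<inter> (M n #> t i))" if "i < L" for i
        by (rule openin_subtopology_Int2[OF coset_open[OF tc(1)[OF that]]])
      then have "openin ?P ?W" by (simp add: openin_PiE)
      moreover have "t \<in> ?W"
        using t tc rcos_self[OF _ subgroup_filtration] by (auto simp: PiE_iff)
      moreover have "?W \<subseteq> ({..<L} \<rightarrow>\<^sub>E H) - ?F n"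
      proof
        fix u assume u: "u \<in> ?W"
        then have uH: "u \<in> {..<L} \<rightarrow>\<^sub>E H" by (auto simp: PiE_iff)
        have sub: "subgroup (generate G (t ` {..<L} \<union> M n)) G"
          using t by (intro generate_is_subgroup car) blast
        have "u i \<in> generate G (t ` {..<L} \<union> M n)" if i: "i < L" for i
        proof -
          have "u i \<in> M n #> t i" using u i by (auto simp: PiE_iff)
          then obtain k where "k \<in> M n" "u i = k \<otimes> t i" unfolding r_coset_def by blast
          then show ?thesis
            using generate.eng[OF generate.incl generate.incl] i by (metis UnCI imageI lessThan_iff)
        qed
        then have "generate G (u ` {..<L} \<union> M n) \<subseteq> generate G (t ` {..<L} \<union> M n)"
          by (intro generate_subgroup_incl[OF _ sub]) (auto intro: generate.incl)
        then show "u \<in> ({..<L} \<rightarrow>\<^sub>E H) - ?F n" using t uH by blast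
      qed
      ultimately show "\<exists>T. openin ?P T \<and> t \<in> T \<and> T \<subseteq> ({..<L} \<rightarrow>\<^sub>E H) - ?F n" by blast
    qed
  qed blast
  have nonempty: "?F n \<noteq> {}" for n
  proof -
    obtain ts where ts: "length ts = L" "set ts \<subseteq> H" "H \<inter> carrier G \<subseteq> generate G (set ts \<union> M n)"
      using L H(1) unfolding generates_traces_def by blast
    let ?t = "restrict ((!) ts) {..<L}"
    have "?t ` {..<L} = set ts" using ts(1) by (auto simp: set_conv_nth)
    moreover have "?t \<in> {..<L} \<rightarrow>\<^sub>E H" using ts(1,2) by auto
    moreover have "H \<subseteq> generate G (set ts \<union> M n)" using ts(3) H.subset by blast
    ultimately have "?t \<in> ?F n" by (simp only: mem_Collect_eq)
    then show ?thesis by (metis (no_types, lifting) empty_iff)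
  qed
  have "decseq ?F"
  proof (rule decseq_SucI)
    fix n
    have "generate G (t ` {..<L} \<union> M (Suc n)) \<subseteq> generate G (t ` {..<L} \<union> M n)" for t :: "nat \<Rightarrow> 'a"
      using Suc_subset by (intro mono_generate) blast
    then show "?F (Suc n) \<subseteq> ?F n" by (intro Collect_mono) (meson subset_trans)
  qed
  then have "(\<Inter>n. ?F n) \<noteq> {}"
    by (rule compact_space_imp_nest[OF comp closed nonempty])
  then obtain t where "\<And>n. t \<in> ?F n" by (meson INT_iff UNIV_I equals0I)
  then have t: "t \<in> {..<L} \<rightarrow>\<^sub>E H" "\<And>n. H \<subseteq> generate G (t ` {..<L} \<union> M n)" by simp_all
  let ?T = "t ` {..<L}"
  have TH: "?T \<subseteq> H" using t(1) by auto
  have "X closure_of (generate G ?T) = H"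
  proof
    show "X closure_of (generate G ?T) \<subseteq> H"
      using closure_of_minimal[OF generate_subgroup_incl[OF TH H(1)] H(2)] .
    show "H \<subseteq> X closure_of (generate G ?T)"
    proof
      fix h assume h: "h \<in> H"
      \<comment> \<open>Generating modulo \<open>M n\<close> means that the generated subgroup meets
        each coset \<open>M n #> h\<close>, and these cosets are the basic neighbourhoods of
        \<open>h\<close>.\<close>
      have "\<exists>y. y \<in> generate G ?T \<and> y \<in> U" if U: "h \<in> U" "openin X U" for U
      proof -
        obtain n where n: "M n #> h \<subseteq> U" using coset_base U by blast
        obtain k y where k: "k \<in> M n" "y \<in> generate G ?T" "h = k \<otimes> y"
          using generate_Un_normal[OF normal, of ?T h n] t h TH H.subset by blast
        have c: "k \<in> carrier G" "y \<in> carrier G"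
          using k filtration_carrier generate_in_carrier[of ?T y] TH H.subset by blast+
        have "y = inv k \<otimes> h" using k c by (simp add: inv_cancel)
        then have "y \<in> M n #> h"
          using subgroup.m_inv_closed[OF subgroup_filtration k(1)] unfolding r_coset_def by blast
        then show ?thesis using n k by blast
      qed
      then show "h \<in> X closure_of (generate G ?T)"
        using h H.subset space by (simp add: in_closure_of subset_iff)
    qed
  qed
  then have "topological_generator_number G X H \<le> enat (card ?T)"
    unfolding topological_generator_number_def using TH by (intro Inf_lower) blast
  also have "\<dots> \<le> enat L" using card_image_le[of "{..<L}" t] by simp
  finally show ?thesis .
qed

end

section \<open>Isometries of trees given by a parent function\<close>

lemma relpow_map:
  assumes "\<And>u v. (u, v) \<in> E \<Longrightarrow> (h u, h v) \<in> E" "(u, v) \<in> E ^^ n"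
  shows "(h u, h v) \<in> E ^^ n"
  using assms(2)
proof (induction n arbitrary: v)
  case (Suc n)
  then obtain w where "(u, w) \<in> E ^^ n" "(w, v) \<in> E" by auto
  then show ?case using Suc.IH assms(1) by (auto intro: relpow_Suc_I)
qed simp

lemma graph_dist_invariant:
  assumes sub: "adj T \<subseteq> verts T \<times> verts T"
    and h: "\<And>u v. (u, v) \<in> adj T \<Longrightarrow> (h u, h v) \<in> adj T"
    and h': "\<And>u v. (u, v) \<in> adj T \<Longrightarrow> (h' u, h' v) \<in> adj T"
    and inv: "h' (h u) = u" "h' (h v) = v"
  shows "graph_dist T (h u) (h v) = graph_dist T u v"
proof -
  have "(h u, h v) \<in> adj T ^^ n \<longleftrightarrow> (u, v) \<in> adj T ^^ n" for n
    using relpow_map[of "adj T" h, OF h] relpow_map[of "adj T" h', OF h'] inv by metis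
  then show ?thesis by (simp add: graph_dist_def)
qed

text \<open>Recovers adjacency from distances, so that isometries preserve edges. Connectedness
  ensures that the \<open>LEAST\<close> in \<open>graph_dist\<close> is attained.\<close>

lemma graph_dist_eq_1_iff:
  assumes "(u, v) \<in> (adj T)\<^sup>*" "u \<noteq> v"
  shows "graph_dist T u v = 1 \<longleftrightarrow> (u, v) \<in> adj T"
proof
  assume "graph_dist T u v = 1"
  moreover have "\<exists>n. (u, v) \<in> adj T ^^ n" using assms(1) by (simp add: rtrancl_power)
  then have "(u, v) \<in> adj T ^^ graph_dist T u v" unfolding graph_dist_def by (rule LeastI_ex)
  ultimately show "(u, v) \<in> adj T" by simp
next
  assume "(u, v) \<in> adj T"
  then show "graph_dist T u v = 1"
    unfolding graph_dist_def using assms(2)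
    by (intro Least_equality) (auto simp: Suc_le_eq intro!: gr0I)
qed

section \<open>Isometry groups, conjugacy and actions\<close>

lemma subgroup_carrier_Iso:
  assumes "root T \<in> verts T"
  shows "subgroup (carrier (Iso T)) (BijGroup (verts T))"
proof (rule subgroup.intro)
  let ?V = "verts T"
  show "carrier (Iso T) \<subseteq> carrier (BijGroup ?V)"
    by (auto simp: Iso_def BijGroup_def)
  show "\<one>\<^bsub>BijGroup ?V\<^esub> \<in> carrier (Iso T)"
    using assms by (auto simp: Iso_def BijGroup_def id_Bij)
  fix x assume x: "x \<in> carrier (Iso T)"
  then have xB: "x \<in> Bij ?V" and xr: "x (root T) = root T"
    and xd: "\<And>u v. u \<in> ?V \<Longrightarrow> v \<in> ?V \<Longrightarrow> graph_dist T (x u) (x v) = graph_dist T u v"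
    by (auto simp: Iso_def)
  have bij: "bij_betw x ?V ?V" using xB by (simp add: Bij_def)
  {
    fix y assume y: "y \<in> carrier (Iso T)"
    then have "y \<in> Bij ?V" by (simp add: Iso_def)
    then have "y ` ?V \<subseteq> ?V" using Bij_imp_funcset by blast
    then show "x \<otimes>\<^bsub>BijGroup ?V\<^esub> y \<in> carrier (Iso T)"
      using x y assms by (auto simp: Iso_def BijGroup_def compose_Bij compose_eq image_subset_iff)
  }
  let ?x = "\<lambda>v\<in>?V. inv_into ?V x v"
  have "?x \<in> Bij ?V" by (rule restrict_inv_into_Bij[OF xB])
  moreover have "?x (root T) = root T"
    using assms xr bij by (metis bij_betw_inv_into_left restrict_apply')
  moreover have "graph_dist T (?x u) (?x v) = graph_dist T u v" if uv: "u \<in> ?V" "v \<in> ?V" for u v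
    using xd[of "?x u" "?x v"] uv bij Bij_inv_into_mem[OF xB] by (simp add: bij_betw_inv_into_right)
  ultimately have "?x \<in> carrier (Iso T)" by (simp add: Iso_def)
  then show "inv\<^bsub>BijGroup ?V\<^esub> x \<in> carrier (Iso T)" using inv_BijGroup[OF xB] by simp
qed

lemma group_Iso: "root T \<in> verts T \<Longrightarrow> group (Iso T)"
  using subgroup.subgroup_is_group[OF subgroup_carrier_Iso group_BijGroup] by (simp add: Iso_def)

lemma Iso_mult_apply:
  assumes "x \<in> carrier (Iso T)" "y \<in> carrier (Iso T)" "v \<in> verts T"
  shows "(x \<otimes>\<^bsub>Iso T\<^esub> y) v = x (y v)"
  using assms by (simp add: Iso_def BijGroup_def compose_eq)

lemma (in group) mem_conjugacy_class:
  assumes "x \<in> carrier G"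
  shows "x \<in> conjugacy_class G x"
proof -
  have "x = \<one> \<otimes> x \<otimes> inv \<one>" using assms by simp
  then show ?thesis unfolding conjugacy_class_def using one_closed by blast
qed

text \<open>Conjugacy in pointwise form: \<open>k\<close> intertwines \<open>x\<close> and
  \<open>y\<close>, so it carries fixed vertices of \<open>x\<close> to fixed vertices of
  \<open>y\<close>.\<close>

lemma same_conjugacy_class_Iso:
  assumes r: "root T \<in> verts T" and x: "x \<in> carrier (Iso T)" and y: "y \<in> carrier (Iso T)"
    and eq: "conjugacy_class (Iso T) x = conjugacy_class (Iso T) y"
  obtains k where "k \<in> carrier (Iso T)" "\<And>v. v \<in> verts T \<Longrightarrow> y (k v) = k (x v)"
proof -
  interpret I: group "Iso T" by (rule group_Iso[OF r])
  have "y \<in> conjugacy_class (Iso T) x" unfolding eq by (rule I.mem_conjugacy_class[OF y])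
  then obtain k where k: "k \<in> carrier (Iso T)"
    and yk: "y = k \<otimes>\<^bsub>Iso T\<^esub> x \<otimes>\<^bsub>Iso T\<^esub> inv\<^bsub>Iso T\<^esub> k"
    unfolding conjugacy_class_def by blast
  then have "y \<otimes>\<^bsub>Iso T\<^esub> k = k \<otimes>\<^bsub>Iso T\<^esub> x" using x by (simp add: I.m_assoc)
  then show thesis using that[OF k] k x y Iso_mult_apply by metis
qed

text \<open>Since \<open>inv g\<close> acts as the inverse of \<open>g\<close>, preservation of
  edges already gives preservation of distances. Restriction to the vertices meets the
  extensionality convention of \<open>Iso\<close>.\<close>

lemma action_hom_Iso:
  fixes G (structure)
  assumes "group G" and r: "root T \<in> verts T" and sub: "adj T \<subseteq> verts T \<times> verts T"
    and maps: "\<And>g v. g \<in> carrier G \<Longrightarrow> v \<in> verts T \<Longrightarrow> \<alpha> g v \<in> verts T"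
    and one: "\<And>v. v \<in> verts T \<Longrightarrow> \<alpha> \<one> v = v"
    and mult: "\<And>g h v. g \<in> carrier G \<Longrightarrow> h \<in> carrier G \<Longrightarrow> v \<in> verts T \<Longrightarrow> \<alpha> (g \<otimes> h) v = \<alpha> g (\<alpha> h v)"
    and root: "\<And>g. g \<in> carrier G \<Longrightarrow> \<alpha> g (root T) = root T"
    and adj: "\<And>g u v. g \<in> carrier G \<Longrightarrow> (u, v) \<in> adj T \<Longrightarrow> (\<alpha> g u, \<alpha> g v) \<in> adj T"
  shows "(\<lambda>g. restrict (\<alpha> g) (verts T)) \<in> hom G (Iso T)"
proof (rule homI)
  interpret group G by fact
  let ?V = "verts T" and ?\<phi> = "\<lambda>g. restrict (\<alpha> g) (verts T)"
  have inv: "\<alpha> (inv g) (\<alpha> g v) = v" "\<alpha> g (\<alpha> (inv g) v) = v" if "g \<in> carrier G" "v \<in> ?V" for g v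
    using that one mult[of "inv g" g v] mult[of g "inv g" v] by simp_all
  show I: "?\<phi> g \<in> carrier (Iso T)" if g: "g \<in> carrier G" for g
  proof -
    have "bij_betw (\<alpha> g) ?V ?V"
      by (rule bij_betw_byWitness[of _ "\<alpha> (inv g)"]) (use g inv maps in auto)
    then have "?\<phi> g \<in> Bij ?V" by (simp add: Bij_def)
    moreover have "graph_dist T (\<alpha> g u) (\<alpha> g v) = graph_dist T u v" if "u \<in> ?V" "v \<in> ?V" for u v
      by (rule graph_dist_invariant[OF sub adj[OF g] adj[OF inv_closed[OF g]]]) (use inv g that in auto)
    ultimately show ?thesis using r root g by (simp add: Iso_def)
  qed
  fix g h assume g: "g \<in> carrier G" and h: "h \<in> carrier G"
  show "?\<phi> (g \<otimes> h) = ?\<phi> g \<otimes>\<^bsub>Iso T\<^esub> ?\<phi> h"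
  proof (rule extensionalityI[of _ ?V])
    show "?\<phi> g \<otimes>\<^bsub>Iso T\<^esub> ?\<phi> h \<in> extensional ?V"
      using I[OF g] I[OF h] by (simp add: Iso_def BijGroup_def)
    fix v assume "v \<in> ?V"
    then show "?\<phi> (g \<otimes> h) v = (?\<phi> g \<otimes>\<^bsub>Iso T\<^esub> ?\<phi> h) v"
      using Iso_mult_apply[OF I[OF g] I[OF h]] mult g h maps by simp
  qed simp
qed

text \<open>A parent map lowering a level by one certifies a tree: following parents connects every
  vertex to the root, and the levels exclude cycles.\<close>

locale levelled_tree =
  fixes V :: "'v set" and r :: 'v and par :: "'v \<Rightarrow> 'v" and lev :: "'v \<Rightarrow> nat"
  assumes root_vert: "r \<in> V" and lev_root: "lev r = 0"
    and par_vert: "v \<in> V \<Longrightarrow> v \<noteq> r \<Longrightarrow> par v \<in> V"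
    and lev_par: "v \<in> V \<Longrightarrow> v \<noteq> r \<Longrightarrow> lev v = Suc (lev (par v))"
begin

definition tree :: "'v rooted_graph" where
  "tree = \<lparr>verts = V, adj = {(u, v). u \<in> V \<and> v \<in> V \<and> (u \<noteq> r \<and> v = par u \<or> v \<noteq> r \<and> u = par v)}, root = r\<rparr>"

lemma tree_simps [simp]: "verts tree = V" "root tree = r"
  by (simp_all add: tree_def)

lemma adj_tree_iff:
  "(u, v) \<in> adj tree \<longleftrightarrow> u \<in> V \<and> v \<in> V \<and> (u \<noteq> r \<and> v = par u \<or> v \<noteq> r \<and> u = par v)"
  by (simp add: tree_def)

lemma adj_tree_cases:
  assumes "(u, v) \<in> adj tree"
  shows "lev u = Suc (lev v) \<and> v = par u \<or> lev v = Suc (lev u) \<and> u = par v"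
  using assms lev_par unfolding adj_tree_iff by metis

lemma sym_adj_tree: "sym (adj tree)"
  by (auto simp: sym_def adj_tree_iff)

lemma relpow_root:
  assumes "v \<in> V"
  shows "(r, v) \<in> adj tree ^^ lev v"
  using assms
proof (induction "lev v" arbitrary: v)
  case 0
  then show ?case using lev_par by force
next
  case (Suc n)
  then have v: "v \<noteq> r" using lev_root by auto
  then have "(r, par v) \<in> adj tree ^^ n" using Suc lev_par[of v] par_vert by simp
  moreover have "(par v, v) \<in> adj tree" using v Suc.prems par_vert by (simp add: adj_tree_iff)
  ultimately show ?case using Suc.hyps(2) by (metis relpow_Suc_I)
qed

lemma lev_le_relpow: "(u, v) \<in> adj tree ^^ n \<Longrightarrow> lev v \<le> lev u + n"
proof (induction n arbitrary: v)
  case (Suc n)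
  then obtain w where "(u, w) \<in> adj tree ^^ n" "(w, v) \<in> adj tree" by auto
  then show ?case using Suc.IH[of w] adj_tree_cases[of w v] by linarith
qed simp

text \<open>The path of parents has length \<open>lev v\<close>, and no edge raises the level by
  more than one. Isometries fixing the root therefore preserve levels.\<close>

lemma graph_dist_root: "v \<in> V \<Longrightarrow> graph_dist tree r v = lev v"
  unfolding graph_dist_def using relpow_root lev_le_relpow[of r v] lev_root
  by (intro Least_equality) auto

lemma connected:
  assumes "u \<in> V" "v \<in> V"
  shows "(u, v) \<in> (adj tree)\<^sup>*"
proof -
  have "(r, u) \<in> (adj tree)\<^sup>*" "(r, v) \<in> (adj tree)\<^sup>*"
    using relpow_root[OF assms(1)] relpow_root[OF assms(2)] by (auto simp: rtrancl_power)
  then show ?thesis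
    using sym_rtrancl[OF sym_adj_tree] by (meson rtrancl_trans symD)
qed

text \<open>Both neighbours of a cycle vertex of maximal level would be its parent.\<close>

lemma no_cycle: "\<not> graph_cycle (adj tree) xs"
proof
  assume c: "graph_cycle (adj tree) xs"
  define n where "n = length xs"
  have n: "3 \<le> n" and d: "distinct xs" and succ: "successively (\<lambda>x y. (x, y) \<in> adj tree) xs"
    and close: "(last xs, hd xs) \<in> adj tree"
    using c by (auto simp: graph_cycle_def n_def)
  define nx where "nx i = (if Suc i = n then 0 else Suc i)" for i
  have edge: "(xs ! i, xs ! nx i) \<in> adj tree" if "i < n" for i
  proof (cases "Suc i = n")
    case True
    have "xs \<noteq> []" using n by (auto simp: n_def)
    then have "xs ! i = last xs" "xs ! 0 = hd xs"
      using last_conv_nth[of xs] hd_conv_nth[of xs] by (auto simp flip: n_def True)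
    then show ?thesis using close True by (simp add: nx_def)
  next
    case False
    then show ?thesis using succ that by (simp add: nx_def successively_conv_nth n_def)
  qed
  have "finite (lev ` set xs)" "lev ` set xs \<noteq> {}" using n by (auto simp: n_def)
  then obtain x where x: "x \<in> set xs" "lev x = Max (lev ` set xs)"
    by (metis Max_in imageE)
  then obtain i where i: "i < n" "xs ! i = x" by (auto simp: in_set_conv_nth n_def)
  define j where "j = (if i = 0 then n - 1 else i - 1)"
  have j: "j < n" "nx j = i" using i n by (auto simp: j_def nx_def)
  have k: "nx i < n" using i n by (auto simp: nx_def)
  have max: "lev (xs ! l) \<le> lev x" if "l < n" for l
    using that x(2) by (simp add: n_def)
  have "xs ! j = par x" using adj_tree_cases[OF edge[OF j(1)]] j i max[OF j(1)] by force
  moreover have "xs ! nx i = par x" using adj_tree_cases[OF edge[OF i(1)]] i max[OF k] by force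
  ultimately have "j = nx i" using nth_eq_iff_index_eq[OF d, of j "nx i"] j(1) k by (simp flip: n_def)
  then show False using n i by (auto simp: j_def nx_def split: if_splits)
qed

lemma rooted_tree: "rooted_tree tree"
proof -
  have "irrefl (adj tree)" using adj_tree_cases by (fastforce simp: irrefl_def)
  then show ?thesis
    using root_vert sym_adj_tree connected no_cycle by (auto simp: rooted_tree_def adj_tree_iff)
qed

end

section \<open>Actions on a spine with finite groups attached\<close>

text \<open>The kernels of the \<open>\<pi> n\<close> stand for open normal subgroups. Separation
  will give faithfulness, and open fibres continuity.\<close>

locale spine_action = group G for G (structure) +
  fixes X :: "'a topology" and Q :: "nat \<Rightarrow> ('q, 'r) monoid_scheme" and \<pi> :: "nat \<Rightarrow> 'a \<Rightarrow> 'q"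
  assumes space: "topspace X = carrier G"
    and group_quot: "group (Q n)"
    and finite_quot: "finite (carrier (Q n))"
    and hom_quot: "\<pi> n \<in> hom G (Q n)"
    and separating: "g \<in> carrier G \<Longrightarrow> (\<And>n. \<pi> n g = \<one>\<^bsub>Q n\<^esub>) \<Longrightarrow> g = \<one>"
    and open_fibre: "openin X {g \<in> carrier G. \<pi> n g = q}"
begin

text \<open>Vertices are coded as natural numbers. A second component 0 marks the ray; leaves have a
  positive one, whence the \<open>Suc\<close> in \<open>leaf\<close>.\<close>

definition spine :: "nat \<Rightarrow> nat" where
  "spine n = prod_encode (n, 0)"

definition leaf :: "nat \<Rightarrow> 'q \<Rightarrow> nat" where
  "leaf n q = prod_encode (n, Suc (to_nat_on (carrier (Q n)) q))"

definition spine_verts :: "nat set" where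
  "spine_verts = range spine \<union> (\<Union>n. leaf n ` carrier (Q n))"

text \<open>Truncated subtraction makes the root its own parent, a default that \<open>tree\<close>
  never turns into an edge.\<close>

definition par :: "nat \<Rightarrow> nat" where
  "par v = (case prod_decode v of (n, i) \<Rightarrow> if i = 0 then spine (n - 1) else spine n)"

definition lev :: "nat \<Rightarrow> nat" where
  "lev v = (case prod_decode v of (n, i) \<Rightarrow> if i = 0 then n else Suc n)"

text \<open>Left translation on each finite quotient, with the ray fixed; \<open>i - 1\<close> and
  \<open>from_nat_into\<close> undo the coding in \<open>leaf\<close>.\<close>

definition act :: "'a \<Rightarrow> nat \<Rightarrow> nat" where
  "act g v = (case prod_decode v of (n, i) \<Rightarrow>
     if i = 0 then v else leaf n (\<pi> n g \<otimes>\<^bsub>Q n\<^esub> from_nat_into (carrier (Q n)) (i - 1)))"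

lemma spine_vert [simp]: "spine n \<in> spine_verts"
  by (simp add: spine_verts_def)

lemma leaf_vert [simp]: "q \<in> carrier (Q n) \<Longrightarrow> leaf n q \<in> spine_verts"
  by (auto simp: spine_verts_def)

lemma spine_verts_cases:
  assumes "v \<in> spine_verts"
  obtains n where "v = spine n" | n q where "q \<in> carrier (Q n)" "v = leaf n q"
  using assms unfolding spine_verts_def by blast

lemma par_lev_simps [simp]:
  "par (spine n) = spine (n - 1)" "par (leaf n q) = spine n"
  "lev (spine n) = n" "lev (leaf n q) = Suc n"
  by (simp_all add: par_def lev_def spine_def leaf_def)

lemma spine_leaf_simps [simp]:
  "spine n = spine m \<longleftrightarrow> n = m" "spine n \<noteq> leaf m q" "leaf m q \<noteq> spine n"
  by (simp_all add: spine_def leaf_def)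

lemma leaf_eq_iff:
  assumes "p \<in> carrier (Q n)" "q \<in> carrier (Q n)"
  shows "leaf n p = leaf n q \<longleftrightarrow> p = q"
  using assms finite_quot[of n] by (simp add: leaf_def countable_finite)

lemma act_spine [simp]: "act g (spine n) = spine n"
  by (simp add: act_def spine_def)

lemma act_leaf [simp]: "q \<in> carrier (Q n) \<Longrightarrow> act g (leaf n q) = leaf n (\<pi> n g \<otimes>\<^bsub>Q n\<^esub> q)"
  using finite_quot[of n] by (simp add: act_def leaf_def countable_finite)

lemma quot_closed: "g \<in> carrier G \<Longrightarrow> \<pi> n g \<in> carrier (Q n)"
  using hom_quot by (rule hom_in_carrier)

lemma quot_one: "\<pi> n \<one> = \<one>\<^bsub>Q n\<^esub>"
  using hom_one[OF hom_quot is_group group_quot] .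

lemma act_vert: "g \<in> carrier G \<Longrightarrow> v \<in> spine_verts \<Longrightarrow> act g v \<in> spine_verts"
  by (erule spine_verts_cases) (simp_all add: quot_closed group_quot group.is_monoid monoid.m_closed)

sublocale levelled_tree spine_verts "spine 0" par lev
proof
  fix v assume "v \<in> spine_verts" "v \<noteq> spine 0"
  then show "par v \<in> spine_verts" "lev v = Suc (lev (par v))"
    by (auto elim!: spine_verts_cases)
qed simp_all

lemma locally_finite_tree: "locally_finite_rooted_tree tree"
  unfolding locally_finite_rooted_tree_def
proof (intro conjI ballI rooted_tree)
  fix v assume "v \<in> verts tree"
  have "{w. (v, w) \<in> adj tree} \<subseteq> {par v} \<union> {w \<in> spine_verts. par w = v}"
    by (auto simp: adj_tree_iff)
  \<comment> \<open>Children of \<open>spine n\<close> are \<open>spine (Suc n)\<close> and the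
    leaves with index \<open>n = lev v\<close>; \<open>spine 0\<close> is listed because it is its
    own default parent.\<close>
  also have "\<dots> \<subseteq> {par v, spine 0, spine (Suc (lev v))} \<union> leaf (lev v) ` carrier (Q (lev v))"
    by (auto elim!: spine_verts_cases)
  finally show "finite {w. (v, w) \<in> adj tree}"
    using finite_quot[of "lev v"] by (auto elim: finite_subset)
qed

lemma act_adj:
  assumes g: "g \<in> carrier G" and uv: "(u, v) \<in> adj tree"
  shows "(act g u, act g v) \<in> adj tree"
proof -
  have "act g (par w) = par (act g w)" "act g w \<noteq> spine 0" if "w \<in> spine_verts" "w \<noteq> spine 0" for w
    using that by (auto elim!: spine_verts_cases)
  then show ?thesis using uv act_vert[OF g] unfolding adj_tree_iff by metis
qed

section \<open>The faithful continuous representation on the spine tree\<close>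

definition spine_rep :: "'a \<Rightarrow> nat \<Rightarrow> nat" where
  "spine_rep g = restrict (act g) spine_verts"

lemma spine_rep_hom: "spine_rep \<in> hom G (Iso tree)"
proof -
  have "(\<lambda>g. restrict (act g) (verts tree)) \<in> hom G (Iso tree)"
  proof (rule action_hom_Iso[OF is_group])
    fix v assume v: "v \<in> verts tree"
    then have v: "v \<in> spine_verts" by simp
    show "act g v \<in> verts tree" if "g \<in> carrier G" for g using that v act_vert by simp
    show "act \<one> v = v"
      using v by (rule spine_verts_cases) (simp_all add: quot_one group_quot group.is_monoid monoid.l_one)
    show "act (g \<otimes> h) v = act g (act h v)" if "g \<in> carrier G" "h \<in> carrier G" for g h
      using v that
      by (elim spine_verts_cases)
        (simp_all add: quot_closed hom_mult[OF hom_quot] group_quot group.is_monoid monoid.m_assoc monoid.m_closed)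
  next
    show "adj tree \<subseteq> verts tree \<times> verts tree" by (auto simp: adj_tree_iff)
    show "(act g u, act g v) \<in> adj tree" if "g \<in> carrier G" "(u, v) \<in> adj tree" for g u v
      using that by (rule act_adj)
  qed simp_all
  then show ?thesis by (simp add: spine_rep_def[abs_def])
qed

text \<open>A translation with one fixed point is trivial. Hence one leaf at \<open>n\<close>
  decides whether \<open>g\<close> lies in the kernel of \<open>\<pi> n\<close>.\<close>

lemma fixes_leaf_iff:
  assumes "g \<in> carrier G" "q \<in> carrier (Q n)"
  shows "act g (leaf n q) = leaf n q \<longleftrightarrow> \<pi> n g = \<one>\<^bsub>Q n\<^esub>"
proof -
  interpret Q: group "Q n" by (rule group_quot)
  show ?thesis using assms quot_closed by (simp add: leaf_eq_iff)
qed

lemma spine_rep_faithful: "inj_on spine_rep (carrier G)"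
proof -
  interpret I: group "Iso tree" by (rule group_Iso) (simp add: root_vert)
  interpret group_hom G "Iso tree" spine_rep
    using spine_rep_hom by unfold_locales
  have "g = \<one>" if g: "g \<in> carrier G" "spine_rep g = \<one>\<^bsub>Iso tree\<^esub>" for g
  proof (rule separating[OF g(1)])
    fix n
    have q: "\<one>\<^bsub>Q n\<^esub> \<in> carrier (Q n)" using group_quot by (simp add: group.is_monoid)
    have "spine_rep g = (\<lambda>v\<in>spine_verts. v)" using g(2) by (simp add: Iso_def BijGroup_def)
    then have "spine_rep g (leaf n \<one>\<^bsub>Q n\<^esub>) = leaf n \<one>\<^bsub>Q n\<^esub>" using q by simp
    then show "\<pi> n g = \<one>\<^bsub>Q n\<^esub>" using fixes_leaf_iff[OF g(1) q] q by (simp add: spine_rep_def)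
  qed
  then show ?thesis by (simp add: inj_on_one_iff)
qed

text \<open>The topology is that of pointwise convergence, and the image of a leaf depends on
  \<open>g\<close> only through \<open>\<pi> n g\<close>, whose fibres are open.\<close>

lemma spine_rep_continuous: "continuous_map X (Iso_topology tree) spine_rep"
  unfolding Iso_topology_def
proof (rule continuous_map_into_subtopology)
  show "spine_rep \<in> topspace X \<rightarrow> carrier (Iso tree)"
    using hom_in_carrier[OF spine_rep_hom] space by auto
  have "continuous_map X (discrete_topology spine_verts) (\<lambda>g. spine_rep g v)" if v: "v \<in> spine_verts" for v
  proof -
    have "openin X {g \<in> carrier G. act g v = w}" for w
      using v
    proof (cases rule: spine_verts_cases)
      case (1 n)
      then show ?thesis using openin_topspace[of X] space by (cases "w = v") simp_all
    next
      case (2 n q)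
      interpret Q: group "Q n" by (rule group_quot)
      have "{g \<in> carrier G. act g v = w} = (\<Union>p\<in>{p. leaf n (p \<otimes>\<^bsub>Q n\<^esub> q) = w}. {g \<in> carrier G. \<pi> n g = p})"
        using 2 by auto
      then show ?thesis using open_fibre by auto
    qed
    moreover have "{g \<in> carrier G. act g v \<in> U} = (\<Union>w\<in>U. {g \<in> carrier G. act g v = w})" for U by blast
    ultimately have "openin X {g \<in> carrier G. act g v \<in> U}" for U by auto
    then show ?thesis
      using v act_vert by (auto simp: continuous_map_def space spine_rep_def)
  qed
  then show "continuous_map X (product_topology (\<lambda>_. discrete_topology (verts tree)) (verts tree)) spine_rep"
    by (auto simp: continuous_map_componentwise spine_rep_def)
qed

lemma spine_rep_faithful_continuous: "faithful_continuous_representation G X tree spine_rep"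
  unfolding faithful_continuous_representation_def
  using spine_rep_hom spine_rep_faithful spine_rep_continuous by blast

section \<open>Rigidity of the ray under isometries\<close>

context
  fixes k assumes k: "k \<in> carrier (Iso tree)"
begin

lemma iso_vert: "v \<in> spine_verts \<Longrightarrow> k v \<in> spine_verts"
  using k Bij_imp_funcset by (fastforce simp: Iso_def)

lemma iso_inj: "inj_on k spine_verts"
  using k by (simp add: Iso_def Bij_def bij_betw_def)

lemma iso_lev:
  assumes "v \<in> spine_verts"
  shows "lev (k v) = lev v"
proof -
  have "\<forall>u\<in>spine_verts. \<forall>v\<in>spine_verts. graph_dist tree (k u) (k v) = graph_dist tree u v"
    and r: "k (spine 0) = spine 0"
    using k by (simp_all add: Iso_def)
  then have "graph_dist tree (k (spine 0)) (k v) = graph_dist tree (spine 0) v"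
    using assms root_vert by blast
  then show ?thesis unfolding r using graph_dist_root assms iso_vert by simp
qed

lemma iso_adj:
  assumes "(u, v) \<in> adj tree"
  shows "(k u, k v) \<in> adj tree"
proof -
  have uv: "u \<in> spine_verts" "v \<in> spine_verts" "u \<noteq> v"
    using assms adj_tree_cases by (force simp: adj_tree_iff)+
  then have "graph_dist tree (k u) (k v) = graph_dist tree u v" using k by (simp add: Iso_def)
  moreover have "k u \<noteq> k v" using uv iso_inj by (simp add: inj_on_eq_iff)
  ultimately show ?thesis
    using graph_dist_eq_1_iff[OF connected[of u v]] graph_dist_eq_1_iff[OF connected[of "k u" "k v"]]
      uv iso_vert assms by simp
qed

text \<open>The only other vertices on the level of \<open>spine n\<close> are leaves, and a leaf
  has no neighbour one level further out, whereas \<open>spine n\<close> has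
  \<open>spine (Suc n)\<close>.\<close>

lemma iso_spine: "k (spine n) = spine n"
proof (cases n)
  case 0
  then show ?thesis using k by (simp add: Iso_def)
next
  case (Suc m)
  have adj: "(k (spine n), k (spine (Suc n))) \<in> adj tree"
    by (rule iso_adj) (simp add: adj_tree_iff)
  have "k (spine n) \<in> spine_verts" by (simp add: iso_vert)
  then show ?thesis
  proof (cases rule: spine_verts_cases)
    case (1 j)
    then show ?thesis using iso_lev[of "spine n"] by simp
  next
    case (2 j q)
    have "lev (k (spine (Suc n))) = Suc (lev (k (spine n)))" by (simp add: iso_lev)
    then have *: "par (k (spine (Suc n))) = leaf j q" using adj_tree_cases[OF adj] 2 by auto
    have "k (spine (Suc n)) \<in> spine_verts" by (simp add: iso_vert)
    then show ?thesis by (cases rule: spine_verts_cases) (use * in auto)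
  qed
qed

text \<open>Level \<open>Suc n\<close> consists of the leaves at \<open>n\<close> and
  \<open>spine (Suc n)\<close>; the latter is already the image of itself.\<close>

lemma iso_leaf:
  assumes "q \<in> carrier (Q n)"
  obtains p where "p \<in> carrier (Q n)" "k (leaf n q) = leaf n p"
proof -
  have "k (leaf n q) \<in> spine_verts" using assms by (simp add: iso_vert)
  moreover have "lev (k (leaf n q)) = Suc n" using assms by (simp add: iso_lev)
  moreover have "k (leaf n q) \<noteq> spine (Suc n)"
    using inj_onD[OF iso_inj, of "leaf n q" "spine (Suc n)"] assms iso_spine by auto
  ultimately show thesis using that by (auto elim!: spine_verts_cases)
qed

end

text \<open>If \<open>g\<close> fixes a leaf at \<open>n\<close>, then \<open>h\<close> fixes its
  image under the conjugating isometry, which is again a leaf at \<open>n\<close>.\<close>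

lemma same_type_imp_same_kernels:
  assumes g: "g \<in> carrier G" and h: "h \<in> carrier G"
    and eq: "conjugacy_class (Iso tree) (spine_rep g) = conjugacy_class (Iso tree) (spine_rep h)"
    and triv: "\<pi> n g = \<one>\<^bsub>Q n\<^esub>"
  shows "\<pi> n h = \<one>\<^bsub>Q n\<^esub>"
proof -
  have I: "spine_rep g \<in> carrier (Iso tree)" "spine_rep h \<in> carrier (Iso tree)"
    using g h hom_in_carrier[OF spine_rep_hom] by blast+
  obtain k where k: "k \<in> carrier (Iso tree)"
    and kv: "\<And>v. v \<in> spine_verts \<Longrightarrow> spine_rep h (k v) = k (spine_rep g v)"
    by (rule same_conjugacy_class_Iso[OF _ I eq]) (auto simp: root_vert)
  have q: "\<one>\<^bsub>Q n\<^esub> \<in> carrier (Q n)" using group_quot by (simp add: group.is_monoid)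
  obtain p where p: "p \<in> carrier (Q n)" "k (leaf n \<one>\<^bsub>Q n\<^esub>) = leaf n p" using iso_leaf[OF k q] .
  have "act h (leaf n p) = leaf n p"
    using kv[of "leaf n \<one>\<^bsub>Q n\<^esub>"] fixes_leaf_iff[OF g q] triv p q by (simp add: spine_rep_def del: act_leaf)
  then show ?thesis using fixes_leaf_iff[OF h p(1)] by blast
qed

end

section \<open>Finite rank\<close>

context normal_filtration
begin

section \<open>Enumerating the open normal subgroups\<close>

lemma rcosets_overgroup_finite:
  assumes "N \<lhd> G" "M n \<subseteq> N"
  shows "finite (rcosets N)"
proof (rule finite_subset)
  have N: "subgroup N G" using assms(1) by (rule normal_imp_subgroup)
  have "N #> x = (\<Union>y\<in>M n #> x. N #> y)" if x: "x \<in> carrier G" for x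
  proof -
    have "N #> y = N #> x" if "y \<in> M n #> x" for y
      using that assms(2) repr_independence[OF _ x N, of y] unfolding r_coset_def by blast
    moreover have "x \<in> M n #> x" using rcos_self[OF x subgroup_filtration] .
    ultimately show ?thesis by blast
  qed
  then show "rcosets N \<subseteq> (\<lambda>C. \<Union>y\<in>C. N #> y) ` (rcosets (M n))"
    unfolding RCOSETS_def by blast
  show "finite ((\<lambda>C. \<Union>y\<in>C. N #> y) ` (rcosets (M n)))"
    using finite_index by blast
qed

text \<open>Each such subgroup is a union of cosets of some \<open>M n\<close>, and for each
  \<open>n\<close> there are finitely many such unions. A single ray can thus carry all the
  quotients.\<close>

lemma countable_open_normal: "countable {N. N \<lhd> G \<and> (\<exists>n. M n \<subseteq> N)}"
proof (rule countable_subset)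
  show "{N. N \<lhd> G \<and> (\<exists>n. M n \<subseteq> N)} \<subseteq> (\<Union>n. \<Union> ` Pow (rcosets (M n)))"
  proof clarify
    fix N n assume N: "N \<lhd> G" "M n \<subseteq> N"
    interpret N: subgroup N G using N(1) by (rule normal_imp_subgroup)
    have "x \<in> M n #> x" if "x \<in> N" for x
      using that by (intro rcos_self[OF _ subgroup_filtration]) simp
    moreover have "M n #> x \<subseteq> N" if "x \<in> N" for x
      using N(2) that by (auto simp: r_coset_def)
    ultimately have "N = \<Union> ((\<lambda>x. M n #> x) ` N)" by fast
    moreover have "(\<lambda>x. M n #> x) ` N \<in> Pow (rcosets (M n))"
      using rcosetsI[OF filtration_carrier] N.subset by auto
    ultimately have "N \<in> \<Union> ` Pow (rcosets (M n))" by (rule image_eqI)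
    then show "N \<in> (\<Union>n. \<Union> ` Pow (rcosets (M n)))" by (rule UN_I[OF UNIV_I])
  qed
  show "countable (\<Union>n. \<Union> ` Pow (rcosets (M n)))"
    by (rule countable_UN) (auto intro: countable_finite finite_index)
qed

lemma trivial_intersection:
  assumes "Hausdorff_space X" "g \<in> carrier G" "\<And>n. g \<in> M n"
  shows "g = \<one>"
proof (rule ccontr)
  assume "g \<noteq> \<one>"
  then obtain U where U: "openin X U" "\<one> \<in> U" "g \<notin> U"
    using assms(1,2) one_closed unfolding Hausdorff_space_def space disjnt_def by (metis disjoint_iff)
  then obtain n where "M n #> \<one> \<subseteq> U" using coset_base by blast
  then show False using assms(3)[of n] U(3) filtration_carrier by (simp add: coset_mult_one subset_iff)
qed

text \<open>All open normal subgroups enter one representation, so an isometry type determines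
  membership in every one of them. Smallness then rules out the Cantor scheme, leaving an open set
  that none of them splits.\<close>

lemma small_imp_unsplit_open:
  assumes Haus: "Hausdorff_space X"
    and small: "\<And>(T :: nat rooted_graph) \<phi>. locally_finite_rooted_tree T \<Longrightarrow>
       faithful_continuous_representation G X T \<phi> \<Longrightarrow> small_number_of_isometry_types G T \<phi>"
  obtains U g where "openin X U" "g \<in> U"
    "\<And>N n h. N \<lhd> G \<Longrightarrow> M n \<subseteq> N \<Longrightarrow> h \<in> U \<Longrightarrow> h \<in> N \<longleftrightarrow> g \<in> N"
proof -
  let ?\<N> = "{N. N \<lhd> G \<and> (\<exists>n. M n \<subseteq> N)}"
  define N where "N = from_nat_into ?\<N>"
  have "?\<N> \<noteq> {}" using normal by blast
  then have rangeN: "range N = ?\<N>"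
    unfolding N_def using countable_open_normal by (rule range_from_nat_into)
  have N: "N k \<lhd> G" "\<exists>n. M n \<subseteq> N k" for k using rangeN by blast+
  have sub: "subgroup (N k) G" for k using N(1) by (rule normal_imp_subgroup)
  have eq_one: "N k #> g = \<one>\<^bsub>G Mod N k\<^esub> \<longleftrightarrow> g \<in> N k" if "g \<in> carrier G" for g k
    using coset_join1[OF _ that sub] coset_join2[OF that sub] subgroup.subset[OF sub]
    by (auto simp: FactGroup_def)
  interpret S: spine_action G X "\<lambda>k. G Mod N k" "\<lambda>k g. N k #> g"
  proof (intro spine_action.intro spine_action_axioms.intro is_group)
    show "topspace X = carrier G" by (rule space)
    show "Group.group (G Mod N k)" for k using N(1) by (rule normal.factorgroup_is_group)
    show "finite (carrier (G Mod N k))" for k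
      using rcosets_overgroup_finite[OF N(1)] N(2)[of k] by (auto simp: FactGroup_def)
    show "(\<lambda>g. N k #> g) \<in> hom G (G Mod N k)" for k using N(1) by (rule normal.r_coset_hom_Mod)
    show "g = \<one>" if g: "g \<in> carrier G" "\<And>k. N k #> g = \<one>\<^bsub>G Mod N k\<^esub>" for g
    proof (rule trivial_intersection[OF Haus g(1)])
      fix n
      have "M n \<in> range N" unfolding rangeN using normal by blast
      then show "g \<in> M n" using g eq_one by blast
    qed
    show "openin X {g \<in> carrier G. N k #> g = q}" for k q
    proof -
      obtain n where n: "M n \<subseteq> N k" using N(2) by blast
      show ?thesis
      proof (rule openin_saturated[of _ n])
        fix x assume x: "x \<in> {g \<in> carrier G. N k #> g = q}"
        show "M n #> x \<subseteq> {g \<in> carrier G. N k #> g = q}"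
        proof
          fix y assume y: "y \<in> M n #> x"
          then have "y \<in> N k #> x" using n unfolding r_coset_def by blast
          then have "N k #> y = q" using repr_independence[OF _ _ sub, of y k x] x by simp
          moreover have "y \<in> carrier G" using y x r_coset_subset_G[OF filtration_carrier] by blast
          ultimately show "y \<in> {g \<in> carrier G. N k #> g = q}" by blast
        qed
      qed blast
    qed
  qed
  let ?T = "S.tree" and ?\<phi> = "S.spine_rep"
  let ?C = "\<lambda>g. conjugacy_class (Iso ?T) (?\<phi> g)"
  have same: "g \<in> N k \<longleftrightarrow> h \<in> N k" if "g \<in> carrier G" "h \<in> carrier G" "?C g = ?C h" for g h k
    using S.same_type_imp_same_kernels[OF that(1,2,3), of k]
      S.same_type_imp_same_kernels[OF that(2,1) that(3)[symmetric], of k] eq_one that by blast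
  have "small_number_of_isometry_types G ?T ?\<phi>"
    by (rule small[OF S.locally_finite_tree S.spine_rep_faithful_continuous])
  then have types: "{C \<in> conjugacy_classes (Iso ?T). C \<inter> ?\<phi> ` carrier G \<noteq> {}} \<prec> (UNIV :: nat set set)"
    unfolding small_number_of_isometry_types_def .
  have "\<exists>U. openin X U \<and> U \<noteq> {} \<and> (\<forall>k. U \<inter> N k = {} \<or> U - N k = {})"
  proof (rule ccontr)
    assume "\<nexists>U. openin X U \<and> U \<noteq> {} \<and> (\<forall>k. U \<inter> N k = {} \<or> U - N k = {})"
    then have "\<exists>k. U \<inter> N k \<noteq> {} \<and> U - N k \<noteq> {}" if "openin X U" "U \<noteq> {}" for U
      using that by blast
    then obtain x :: "nat set \<Rightarrow> 'a" where x: "\<And>A. x A \<in> carrier G"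
      and split: "\<And>A B. A \<noteq> B \<Longrightarrow> \<exists>k. x A \<in> N k \<longleftrightarrow> x B \<notin> N k"
      using cantor_scheme[of N] N by metis
    \<comment> \<open>Points separated by some \<open>N k\<close> have different types, so the power
      set of the naturals embeds into the set of types met by the image.\<close>
    have "inj (\<lambda>A. ?C (x A))"
      using split same x by (intro injI) metis
    moreover have "?C (x A) \<in> {C \<in> conjugacy_classes (Iso ?T). C \<inter> ?\<phi> ` carrier G \<noteq> {}}" for A
    proof -
      have I: "?\<phi> (x A) \<in> carrier (Iso ?T)" using hom_in_carrier[OF S.spine_rep_hom x] .
      have "group (Iso ?T)" by (rule group_Iso) (simp add: S.root_vert)
      then have "?\<phi> (x A) \<in> ?C (x A)" using I by (rule group.mem_conjugacy_class)
      then show ?thesis using x I by (auto simp: conjugacy_classes_def)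
    qed
    ultimately have "(UNIV :: nat set set) \<lesssim> {C \<in> conjugacy_classes (Iso ?T). C \<inter> ?\<phi> ` carrier G \<noteq> {}}"
      unfolding lepoll_def by blast
    then show False using types by (meson lepoll_antisym lesspoll_def)
  qed
  then obtain U g where U: "openin X U" "g \<in> U" "\<And>k. U \<inter> N k = {} \<or> U - N k = {}" by blast
  have "h \<in> N' \<longleftrightarrow> g \<in> N'" if "N' \<lhd> G" "M n \<subseteq> N'" "h \<in> U" for N' n h
  proof -
    have "N' \<in> range N" unfolding rangeN using that by blast
    then show ?thesis using U that by blast
  qed
  then show thesis using that U by blast
qed

lemma profinite_rank_finite:
  assumes "Hausdorff_space X" and nil: "lower_central_series G c = {\<one>}"
    and "\<And>(T :: nat rooted_graph) \<phi>. locally_finite_rooted_tree T \<Longrightarrow>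
       faithful_continuous_representation G X T \<phi> \<Longrightarrow> small_number_of_isometry_types G T \<phi>"
  shows "profinite_rank G X < \<infinity>"
proof -
  obtain U g where U: "openin X U" "g \<in> U"
    "\<And>N n h. N \<lhd> G \<Longrightarrow> M n \<subseteq> N \<Longrightarrow> h \<in> U \<Longrightarrow> h \<in> N \<longleftrightarrow> g \<in> N"
    using small_imp_unsplit_open[OF assms(1,3)] by blast
  obtain ss where ss: "set ss \<subseteq> carrier G" "\<And>n. generate G (set ss \<union> M n) = carrier G"
    by (rule topologically_finitely_generated[OF nil U(1,2)]) (use U(3) in blast)+
  \<comment> \<open>With \<open>d = length ss\<close> this is \<open>d + d^2 + ... + d^c\<close>,
    fixed before the quotient is chosen.\<close>
  define L where "L = (\<Sum>j<c. length ss ^ Suc j)"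
  have "generates_traces (M n) (carrier G) L" for n
    unfolding L_def by (rule nilpotent_generates_traces[OF nil ss(1) normal ss(2)])
  then have "profinite_rank G X \<le> enat L"
    unfolding profinite_rank_def by (intro SUP_least) (use closed_subgroup_generators in blast)
  then show ?thesis by (meson enat_ord_code(4) le_less_trans)
qed

end

text \<open>The filtration consists of the kernels of the coordinate maps. Their cosets are fibres
  over finite groups, so the index is finite even if the bonding maps are not onto.\<close>

lemma inverse_limit_filtration:
  fixes G :: "('a, 'b) monoid_scheme" (structure)
  assumes pro: "profinite_group G X"
    and K: "finite_group_inverse_sequence K f"
    and iso: "topological_group_isomorphic G X (inverse_limit K f) (inverse_limit_topology K f)"
  obtains M where "normal_filtration G X M"
proof -
  let ?I = "inverse_limit K f" and ?Y = "inverse_limit_topology K f"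
  let ?P = "product_topology (\<lambda>n. discrete_topology (carrier (K n))) UNIV"
  have "group G" and space: "topspace X = carrier G" and compact: "compact_space X"
    using pro by (auto simp: profinite_group_def topological_group_def)
  interpret group G by fact
  have gK: "group (K n)" and finK: "finite (carrier (K n))" and fK: "f n \<in> hom (K (Suc n)) (K n)" for n
    using K by (auto simp: finite_group_inverse_sequence_def)
  obtain \<psi> where \<psi>: "\<psi> \<in> iso G ?I" and hm: "homeomorphic_map X ?Y \<psi>"
    using iso unfolding topological_group_isomorphic_def by blast
  define p where "p n x = \<psi> x n" for n x
  have car: "\<psi> x \<in> carrier ?I" if "x \<in> carrier G" for x
    using \<psi> that by (auto simp: iso_def hom_def)
  have inj: "inj_on \<psi> (carrier G)" using \<psi> by (auto simp: iso_def bij_betw_def)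
  have bond: "f n (p (Suc n) x) = p n x" if "x \<in> carrier G" for n x
    using car[OF that] by (simp add: inverse_limit_def p_def)
  have hom: "p n \<in> hom G (K n)" for n
  proof (rule homI)
    show "p n x \<in> carrier (K n)" if "x \<in> carrier G" for x
      using car[OF that] by (auto simp: inverse_limit_def p_def)
    show "p n (x \<otimes> y) = p n x \<otimes>\<^bsub>K n\<^esub> p n y" if "x \<in> carrier G" "y \<in> carrier G" for x y
    proof -
      have "\<psi> (x \<otimes> y) = \<psi> x \<otimes>\<^bsub>?I\<^esub> \<psi> y" using \<psi> that by (auto simp: iso_def hom_def)
      then show ?thesis by (simp add: inverse_limit_def p_def)
    qed
  qed
  have gh: "group_hom G (K n) (p n)" for n
    using hom gK \<open>group G\<close> by (simp add: group_hom_def group_hom_axioms_def)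
  define M where "M n = kernel G (K n) (p n)" for n
  have coset: "M n #> x = {y \<in> carrier G. p n y = p n x}" if x: "x \<in> carrier G" for n x
  proof -
    interpret h: group_hom G "K n" "p n" by (rule gh)
    have "y \<in> M n #> x" if y: "y \<in> carrier G" "p n y = p n x" for y
    proof -
      have "y \<otimes> inv x \<in> M n" using x y by (simp add: M_def kernel_def)
      moreover have "y = y \<otimes> inv x \<otimes> x" using x y by (simp add: m_assoc)
      ultimately show ?thesis unfolding r_coset_def by blast
    qed
    then show ?thesis using x by (auto simp: M_def kernel_def r_coset_def)
  qed
  \<comment> \<open>The bonding maps compute earlier coordinates from later ones.\<close>
  have compat: "p i y = p i x" if "p n y = p n x" "i \<le> n" "x \<in> carrier G" "y \<in> carrier G" for i n x y
    using that(2,1)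
  proof (induction rule: dec_induct)
    case (step n)
    then show ?case using bond that(3,4) by metis
  qed
  have "normal_filtration G X M"
  proof (intro normal_filtration.intro normal_filtration_axioms.intro)
    show "M n \<lhd> G" for n unfolding M_def by (rule group_hom.normal_kernel[OF gh])
    show "M (Suc n) \<subseteq> M n" for n
    proof
      fix x assume x: "x \<in> M (Suc n)"
      then have "p n x = f n \<one>\<^bsub>K (Suc n)\<^esub>" using bond[of x n] by (simp add: M_def kernel_def)
      then show "x \<in> M n" using x hom_one[OF fK gK gK] by (simp add: M_def kernel_def)
    qed
    show "finite (rcosets (M n))" for n
    proof (rule finite_subset)
      show "rcosets (M n) \<subseteq> (\<lambda>c. {y \<in> carrier G. p n y = c}) ` carrier (K n)"
        using coset hom_in_carrier[OF hom] by (auto simp: RCOSETS_def)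
    qed (use finK in blast)
    show "openin X (M n #> x)" if x: "x \<in> carrier G" for n x
    proof -
      have "continuous_map X ?P \<psi>"
        using homeomorphic_imp_continuous_map[OF hm] unfolding inverse_limit_topology_def
        by (rule continuous_map_into_fulltopology)
      then have "continuous_map X (discrete_topology (carrier (K n))) (p n)"
        unfolding p_def by (simp add: continuous_map_componentwise_UNIV)
      then have "openin X {y \<in> topspace X. p n y \<in> {p n x}}"
        by (rule openin_continuous_map_preimage) (use hom_in_carrier[OF hom x] in simp)
      then show ?thesis using x by (simp add: coset space)
    qed
    show "\<exists>n. M n #> x \<subseteq> U" if U: "openin X U" "x \<in> U" for U x
    proof -
      have Uc: "U \<subseteq> carrier G" using U(1) openin_subset space by blast
      have "openin ?Y (\<psi> ` U)"
        using homeomorphic_imp_open_map[OF hm] U(1) by (simp add: open_map_def)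
      then obtain W where W: "openin ?P W" "\<psi> ` U = W \<inter> carrier ?I"
        unfolding inverse_limit_topology_def openin_subtopology by blast
      then have "\<psi> x \<in> W" using U(2) by blast
      then obtain B where B: "finite {i. B i \<noteq> carrier (K i)}" "\<psi> x \<in> Pi\<^sub>E UNIV B" "Pi\<^sub>E UNIV B \<subseteq> W"
        using W(1) unfolding openin_product_topology_alt by fastforce
      \<comment> \<open>A basic box restricts finitely many coordinates; agreement in coordinate
        \<open>n\<close>, beyond which nothing is restricted, controls all of them.\<close>
      obtain n where n: "\<And>i. B i \<noteq> carrier (K i) \<Longrightarrow> i \<le> n"
        using B(1) unfolding finite_nat_set_iff_bounded_le by blast
      have "M n #> x \<subseteq> U"
      proof
        fix y assume "y \<in> M n #> x"
        then have y: "y \<in> carrier G" "p n y = p n x" using coset U(2) Uc by blast+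
        have "\<psi> y i \<in> B i" for i
        proof (cases "i \<le> n")
          case True
          then have "p i y = p i x" using compat y U(2) Uc by blast
          then show ?thesis using B(2) by (auto simp: p_def PiE_iff)
        next
          case False
          then have "B i = carrier (K i)" using n by blast
          then show ?thesis using hom_in_carrier[OF hom y(1), of i] by (simp add: p_def)
        qed
        then have "\<psi> y \<in> W" using B(3) by auto
        then have "\<psi> y \<in> \<psi> ` U" using W(2) car[OF y(1)] by blast
        then show "y \<in> U" using inj y(1) Uc by (auto dest: inj_onD)
      qed
      then show ?thesis by blast
    qed
  qed (use \<open>group G\<close> space compact in auto)
  then show thesis by (rule that)
qed

theorem theorem2p8:
  fixes G :: "('a, 'b) monoid_scheme" and X :: "'a topology"
    and K :: "nat \<Rightarrow> ('c, 'd) monoid_scheme" and f :: "nat \<Rightarrow> 'c \<Rightarrow> 'c"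
  assumes "profinite_group G X"
    and "nilpotent_group G"
    and "finite_group_inverse_sequence K f"
    and "topological_group_isomorphic G X (inverse_limit K f) (inverse_limit_topology K f)"
    and "\<And>(T :: nat rooted_graph) \<phi>.
           locally_finite_rooted_tree T \<Longrightarrow>
           faithful_continuous_representation G X T \<phi> \<Longrightarrow>
           small_number_of_isometry_types G T \<phi>"
  shows "profinite_rank G X < \<infinity>"
proof -
  obtain M where "normal_filtration G X M"
    using inverse_limit_filtration[OF assms(1,3,4)] .
  moreover obtain c where "lower_central_series G c = {\<one>\<^bsub>G\<^esub>}"
    using assms(2) by (auto simp: nilpotent_group_def)
  moreover have "Hausdorff_space X" using assms(1) by (simp add: profinite_group_def)
  ultimately show ?thesis using normal_filtration.profinite_rank_finite assms(5) by blast
qed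

end
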